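(* Let $I=[0,1]$ and let $X$ be a complete separable metric space. There exist a probability space $(I,\mathcal{I},\lambda)$ extending the Lebesgue unit interval, a probability space $(\Omega,\mathcal{F},P)$, and a Fubini extension $(I\times\Omega,\mathcal{I}\boxtimes\mathcal{F},\lambda\boxtimes P)$ of the usual product probability space $(I\times\Omega,\mathcal{I}\otimes\mathcal{F},\lambda\otimes P)$ such that the following holds: for any measurable mapping $\varphi$ from $(I,\mathcal{I},\lambda)$ to the space $\mathcal{M}(X)$ of Borel probability measures on $X$, there is an $\mathcal{I}\boxtimes\mathcal{F}$-measurable process $f$ from $I\times\Omega$ to $X$ such that the random variables $f_i$ are essentially pairwise independent, and the distribution $P f_i^{-1}$ is the given distribution $\varphi(i)$ for $\lambda$-almost all $i\in I$.
   Context: The Lebesgue unit interval is $(L,\mathcal{L},\eta)$, where $L=[0,1]$, $\mathcal{L}$ is the $\sigma$-algebra of Lebesgue measurable subsets of $[0,1]$, and $\eta$ is Lebesgue measure on $\mathcal{L}$. A probability space $(I,\mathcal{I},\lambda)$ extends the Lebesgue unit interval if $I=[0,1]$, $\mathcal{L}\subseteq\mathcal{I}$, and $\lambda$ restricted to $\mathcal{L}$ equals $\eta$. For a function $f$ on $I\times\Omega$, write $f_i=f(i,\cdot)$ and $f_\omega=f(\cdot,\omega)$. Process: given probability spaces $(I,\mathcal{I},\lambda)$ and $(\Omega,\mathcal{F},P)$ and a complete separable metric space $X$ with Borel $\sigma$-algebra $\mathcal{B}$, a process $f$ from $I\times\Omega$ to $X$ is a mapping $f:I\times\Omega\to X$ such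 that (1) for $\lambda$-almost all $i\in I$, $f_i$ is a random variable on $(\Omega,\mathcal{F},P)$, with distribution $Pf_i^{-1}$ on $X$ defined by $Pf_i^{-1}(B)=P[f_i^{-1}(B)]$ for $B\in\mathcal{B}$; (2) for every $B\in\mathcal{B}$, the mapping $i\mapsto Pf_i^{-1}(B)$ is $\mathcal{I}$-measurable. Essential pairwise independence: a process $f$ is essentially pairwise independent (equivalently, the random variables $f_i$ are essentially pairwise independent) if for $\lambda$-almost all $s\in I$, the random variables $f_s$ and $f_i$ are independent for $\lambda$-almost all $i\in I$. Fubini extension: a probability space $(I\times\Omega,\mathcal{W},Q)$ extending the usual product probability space $(I\times\Omega,\mathcal{I}\otimes\mathcal{F},\lambda\otimes P)$ (i.e. $\mathcal{I}\otimes\mathcal{F}\subseteq\mathcal{W}$ and $Q$ agrees with $\lambda\otimes P$ on $\mathcal{I}\otimes\mathcal{F}$) is a Fubini extension if for any real-valued $Q$-integrable function $f$ on $(I\times\Omega,\mathcal{W})$: (1) $f_i$ is integrable on $(\Omega,\mathcal{F},P)$ for $\lambda$-almost all $i\in I$, and $f_\omega$ is integrable on $(I,\mathcal{I},\lambda)$ for $P$-almost all $\omega\in\Omega$; (2) $\int_\Omega f_i\,dP$ and $\int_I f_\omega\,d\lambda$ are integrable respectively on $(I,\mathcal{I},\lambda)$ and $(\Omega,\mathcal{F},P)$, with $\int_{I\times\Omega}f\,dQ=\int_I\left(\int_\Omega f_i\,dP\right)d\lambda=\int_\Omega\left(\int_I f_\omega\,d\lambda\right)dP$. Such a space is denoted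 $(I\times\Omega,\mathcal{I}\boxtimes\mathcal{F},\lambda\boxtimes P)$. The space $\mathcal{M}(X)$ is endowed with the topology of weak convergence of measures (and its Borel $\sigma$-algebra); measurability of $\varphi$ is equivalent to $\mathcal{I}$-measurability of the mappings $i\mapsto\varphi(i)(B)$ for all $B\in\mathcal{B}$. *)

theory Defs
  imports "HOL-Probability.Probability"
begin

definition measure_extension :: "'a measure \<Rightarrow> 'a measure \<Rightarrow> bool" where
  "measure_extension M N \<longleftrightarrow>
     space N = space M \<and> sets M \<subseteq> sets N \<and> (\<forall>A\<in>sets M. emeasure N A = emeasure M A)"

definition borel_prob_measures :: "'a::topological_space measure set" where
  "borel_prob_measures = {\<mu>. sets \<mu> = sets borel \<and> prob_space \<mu>}"

text \<open>The topology of weak convergence: the coarsest topology making every map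
  \<open>\<mu> \<mapsto> \<integral>g d\<mu>\<close> with \<open>g\<close> bounded and continuous continuous.\<close>

definition weak_topology :: "'a::topological_space measure topology" where
  "weak_topology = topology_generated_by
     {{\<mu> \<in> borel_prob_measures. (\<integral>x. g x \<partial>\<mu>) \<in> U} | (g :: 'a \<Rightarrow> real) U.
        continuous_on UNIV g \<and> bounded (range g) \<and> open U}"

definition weak_borel :: "'a::topological_space measure measure" where
  "weak_borel = sigma borel_prob_measures {U. openin weak_topology U}"

lemma topspace_weak_topology:
  "topspace (weak_topology :: 'a::topological_space measure topology) = borel_prob_measures"
proof -
  let ?S = "{{\<mu> \<in> borel_prob_measures. (\<integral>x. g x \<partial>\<mu>) \<in> U} | (g :: 'a \<Rightarrow> real) U.
        continuous_on UNIV g \<and> bounded (range g) \<and> open U}"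
  have "borel_prob_measures \<in> ?S"
    by (intro CollectI exI[of _ "\<lambda>_. 0"] exI[of _ UNIV]) auto
  then have "\<Union>?S = borel_prob_measures" by blast
  then show ?thesis
    unfolding weak_topology_def by simp
qed

lemma space_weak_borel: "space weak_borel = borel_prob_measures"
  unfolding weak_borel_def
  by (rule space_measure_of) (auto simp flip: topspace_weak_topology dest: openin_subset)

lemma sets_weak_borel:
  "sets weak_borel = sigma_sets borel_prob_measures {U. openin weak_topology U}"
  unfolding weak_borel_def
  by (rule sets_measure_of) (auto simp flip: topspace_weak_topology dest: openin_subset)

text \<open>At the indices of the null set where \<open>f\<^sub>i\<close> is not a random variable, the
  distribution \<open>distr P borel f\<^sub>i\<close> is a default value of the library; likewise, in
  \<open>fubini_extension\<close> below, the integral of a non-integrable section is 0. So in both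
  definitions measurability is required of functions defined on the whole space, which is
  at least as strong as requiring it off a measurable null set.\<close>

definition process ::
    "'i measure \<Rightarrow> 'w measure \<Rightarrow> ('i \<times> 'w \<Rightarrow> 'x::topological_space) \<Rightarrow> bool" where
  "process \<Lambda> P f \<longleftrightarrow>
     (AE i in \<Lambda>. (\<lambda>\<omega>. f (i, \<omega>)) \<in> borel_measurable P) \<and>
     (\<forall>B\<in>sets borel. (\<lambda>i. measure (distr P borel (\<lambda>\<omega>. f (i, \<omega>))) B) \<in> borel_measurable \<Lambda>)"

definition essentially_pairwise_independent ::
    "'i measure \<Rightarrow> 'w measure \<Rightarrow> ('i \<times> 'w \<Rightarrow> 'x::topological_space) \<Rightarrow> bool" where
  "essentially_pairwise_independent \<Lambda> P f \<longleftrightarrow>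
     (AE s in \<Lambda>. AE i in \<Lambda>.
        prob_space.indep_var P borel (\<lambda>\<omega>. f (s, \<omega>)) borel (\<lambda>\<omega>. f (i, \<omega>)))"

definition fubini_extension ::
    "'i measure \<Rightarrow> 'w measure \<Rightarrow> ('i \<times> 'w) measure \<Rightarrow> bool" where
  "fubini_extension \<Lambda> P W \<longleftrightarrow>
     prob_space W \<and> measure_extension (\<Lambda> \<Otimes>\<^sub>M P) W \<and>
     (\<forall>f :: 'i \<times> 'w \<Rightarrow> real. integrable W f \<longrightarrow>
        (AE i in \<Lambda>. integrable P (\<lambda>\<omega>. f (i, \<omega>))) \<and>
        (AE \<omega> in P. integrable \<Lambda> (\<lambda>i. f (i, \<omega>))) \<and>
        integrable \<Lambda> (\<lambda>i. \<integral>\<omega>. f (i, \<omega>) \<partial>P) \<and>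
        integrable P (\<lambda>\<omega>. \<integral>i. f (i, \<omega>) \<partial>\<Lambda>) \<and>
        (\<integral>z. f z \<partial>W) = (\<integral>i. (\<integral>\<omega>. f (i, \<omega>) \<partial>P) \<partial>\<Lambda>) \<and>
        (\<integral>z. f z \<partial>W) = (\<integral>\<omega>. (\<integral>i. f (i, \<omega>) \<partial>\<Lambda>) \<partial>P))"

end

theory Submission
  imports Defs
begin

text \<open>
  By transfinite recursion of length continuum one builds a matrix \<open>M j i\<close> of reals, with row \<open>0\<close>
  the identity, such that its rows \<open>M j\<close> meet every set of positive measure for the power of the
  uniform distribution on \<open>\<real>\<close>-indexed families, and so do its columns \<open>\<lambda>j. M j i\<close> with
  \<open>i \<in> {0..1}\<close>: every set of positive measure contains a cylinder over a compact set of sequences,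
  there are only continuum many of these, and before each step fewer than continuum many cells are
  filled. Pulling the product measure back along the columns gives a measure on \<open>{0..1}\<close> under which
  the maps \<open>M j\<close> are independent and uniform; row \<open>0\<close> makes it extend Lebesgue measure. Pulling it
  back along the rows gives the sample space, on which the variables \<open>j \<mapsto> M j i\<close> are independent
  and uniform. A measurable set of indices depends on countably many rows only and hence is
  independent of all the other rows, and symmetrically for events. So on the \<open>\<sigma>\<close>-algebra generated by
  the product and the map \<open>M\<close> the two iterated integrals agree on generators, and this defines
  the Fubini extension. A process with given distributions arises from \<open>M\<close> by applying to it the
  quantile transformations of these distributions.
\<close>

section \<open>The uniform distribution on the line and its powers\<close>

text \<open>Carried by the whole line instead of the unit interval, so that its powers live on all
  families of reals and the countable power has the Borel sets of a Polish space.\<close>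

definition unif :: "real measure" where
  "unif = uniform_measure lborel {0<..<1}"

unbundle cardinal_syntax

lemma sets_unif [simp, measurable_cong]: "sets unif = sets borel"
  by (simp add: unif_def)

lemma space_unif [simp]: "space unif = UNIV"
  by (simp add: unif_def)

lemma emeasure_unif: "A \<in> sets borel \<Longrightarrow> emeasure unif A = emeasure lborel ({0<..<1} \<inter> A)"
  by (simp add: unif_def divide_ennreal_def)

interpretation unif: prob_space unif
  unfolding unif_def by (rule prob_space_uniform_measure) auto

interpretation unif_prod: product_prob_space "\<lambda>_. unif" UNIV
  by unfold_locales

lemma emeasure_unif_singleton: "emeasure unif {x} = 0"
proof -
  have "emeasure lborel ({0<..<1} \<inter> {x}) \<le> emeasure lborel {x}"
    by (rule emeasure_mono) auto
  then show ?thesis by (simp add: emeasure_unif)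
qed

section \<open>A generic matrix\<close>

lemma sets_borel_seq: "sets (Pi\<^sub>M (UNIV :: nat set) (\<lambda>_. unif)) = sets borel"
proof -
  have "sets (Pi\<^sub>M (UNIV :: nat set) (\<lambda>_. unif)) = sets (Pi\<^sub>M UNIV (\<lambda>_. borel))"
    by (intro sets_PiM_cong) auto
  then show ?thesis by (simp add: sets_PiM_equal_borel)
qed

text \<open>The distribution function \<open>F\<close> of Lebesgue measure restricted to
  \<open>S\<close> is continuous, and its values on \<open>S\<close> already cover an open interval,
  because the leftmost point of a level set belongs to \<open>S\<close>. Hence the image of
  \<open>S\<close> contains continuum many points.\<close>

lemma positive_measure_compact_lepoll:
  fixes S :: "real set"
  assumes "compact S" and pos: "emeasure lborel S > 0"
  shows "(UNIV :: real set) \<lesssim> S"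
proof -
  have cl: "closed S" using assms by (simp add: compact_imp_closed)
  obtain b where b: "\<And>x. x \<in> S \<Longrightarrow> \<bar>x\<bar> \<le> b"
    using compact_imp_bounded[OF \<open>compact S\<close>] by (auto simp: bounded_real)
  have [measurable]: "S \<in> sets borel" using cl by auto
  define F where "F t = measure lborel (S \<inter> {..t})" for t
  have fin: "emeasure lborel A < \<infinity>" if "A \<subseteq> S" for A
  proof -
    have "emeasure lborel A \<le> emeasure lborel S" using that by (intro emeasure_mono) auto
    also have "\<dots> < \<infinity>" by (rule emeasure_bounded_finite) (rule compact_imp_bounded[OF \<open>compact S\<close>])
    finally show ?thesis .
  qed
  have diff: "F t - F s = measure lborel (S \<inter> {s<..t})" if "s \<le> t" for s t
  proof -
    have "S \<inter> {..t} = (S \<inter> {..s}) \<union> (S \<inter> {s<..t})" using that by auto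
    then have "F t = F s + measure lborel (S \<inter> {s<..t})"
      unfolding F_def using fin[of "S \<inter> {..s}"] fin[of "S \<inter> {s<..t}"]
      by (subst measure_Un2[symmetric] measure_Union[symmetric])
         (auto intro!: measure_Union simp: less_top)
    then show ?thesis by simp
  qed
  have lip: "\<bar>F t - F s\<bar> \<le> \<bar>t - s\<bar>" for s t
  proof -
    have *: "\<bar>F t - F s\<bar> \<le> t - s" if "s \<le> t" for s t
    proof -
      have "measure lborel (S \<inter> {s<..t}) \<le> measure lborel {s<..t}"
        using that by (intro measure_mono_fmeasurable) (auto simp: fmeasurable_def)
      then show ?thesis using that by (simp add: diff)
    qed
    show ?thesis using *[of s t] *[of t s] by (cases "s \<le> t") (auto simp: abs_minus_commute)
  qed
  have cont: "continuous_on A F" for A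
  proof (rule continuous_onI)
    fix x e :: real assume "e > 0"
    then show "\<exists>d>0. \<forall>x'\<in>A. dist x' x < d \<longrightarrow> dist (F x') (F x) \<le> e"
      using lip by (intro exI[of _ e]) (auto simp: dist_real_def intro: order_trans[OF _ less_imp_le])
  qed
  have S_eq: "S \<inter> {..b} = S" "S \<inter> {..-b-1} = {}" using b by (auto dest: b)
  have "F b > 0" using pos fin[of S] by (simp add: F_def S_eq(1) measure_def enn2real_positive_iff)
  have "F (-b-1) = 0" by (simp add: F_def S_eq)
  have "{0<..<F b} \<subseteq> F ` S"
  proof
    fix y assume y: "y \<in> {0<..<F b}"
    have bb: "-b-1 \<le> b" using y b by (cases "S = {}") (force simp: F_def)+
    define C where "C = {-b-1..b} \<inter> F -` {y}"
    have "compact C"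
      unfolding C_def using continuous_closed_preimage[OF cont[of "{-b-1..b}"], of "{y}"]
      by (simp add: compact_eq_bounded_closed bounded_Int)
    moreover have "\<exists>x\<ge>-b-1. x \<le> b \<and> F x = y"
      using y bb \<open>F (-b-1) = 0\<close> by (intro IVT' cont) auto
    then have "C \<noteq> {}" by (auto simp: C_def)
    ultimately obtain t where t: "t \<in> C" "\<And>x. x \<in> C \<Longrightarrow> t \<le> x"
      using compact_attains_inf[of C] by metis
    \<comment> \<open>Off the closed set \<open>S\<close> the function \<open>F\<close> is locally
      constant, so the level set would contain a point further left. The maximum in \<open>s\<close>
      keeps that point within the interval of \<open>C\<close>.\<close>
    have "t \<in> S"
    proof (rule ccontr)
      assume "t \<notin> S"
      then have "open (- S)" "t \<in> - S" using cl by auto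
      then obtain e where e: "e > 0" "ball t e \<subseteq> - S"
        using open_contains_ball by blast
      define s where "s = max (t - e/2) (-b-1)"
      have "F t = y" "-b-1 \<le> t" using t(1) by (auto simp: C_def)
      then have "t \<noteq> -b-1" using y \<open>F (-b-1) = 0\<close> by (metis greaterThanLessThan_iff less_irrefl)
      then have s: "s < t" "-b-1 \<le> s" "t - e < s" using \<open>-b-1 \<le> t\<close> e(1) by (auto simp: s_def)
      have "S \<inter> {s<..t} = {}"
        using e(2) s(3) by (auto simp: subset_eq dist_real_def)
      then have "F s = y" using diff[of s t] s(1) \<open>F t = y\<close> by simp
      then have "s \<in> C" using s t(1) by (auto simp: C_def)
      then show False using t(2)[of s] s(1) by simp
    qed
    then show "y \<in> F ` S" using t(1) by (auto simp: C_def)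
  qed
  moreover have "(UNIV :: real set) \<approx> {0<..<F b}"
    using \<open>F b > 0\<close> by (intro eqpoll_sym[OF eqpoll_real_subset]) auto
  ultimately show ?thesis
    by (meson eqpoll_imp_lepoll image_lepoll lepoll_trans subset_imp_lepoll)
qed

section \<open>Counting requests and the rows and columns they touch\<close>

text \<open>This bounds the number of requests by the continuum. A triple is recorded as one set of
  naturals; a closed set is determined by the members of a countable basis that miss it.\<close>

lemma inj_on_closed_code:
  "\<exists>g :: bool \<times> (nat \<Rightarrow> real) \<times> (nat \<Rightarrow> real) set \<Rightarrow> real. inj_on g {(b, D, K). closed K}"
proof -
  obtain h :: "real \<Rightarrow> nat set" where h: "inj h"
    using nat_sets_eqpoll_reals by (metis bij_betw_def eqpoll_def eqpoll_sym)
  obtain k :: "nat set \<Rightarrow> real" where k: "inj k"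
    using nat_sets_eqpoll_reals by (metis bij_betw_def eqpoll_def)
  obtain B :: "(nat \<Rightarrow> real) set set" where B: "countable B" "topological_basis B"
    using ex_countable_basis by blast
  have "B \<noteq> {}" using B(2) by (force simp: topological_basis_def)
  define V where "V = from_nat_into B"
  have V: "range V = B" unfolding V_def using \<open>B \<noteq> {}\<close> B(1) by (rule range_from_nat_into)
  have K_eq: "- \<Union>{V n |n. V n \<inter> K = {}} = K" if "closed K" for K
  proof -
    have "\<exists>n. x \<in> V n \<and> V n \<inter> K = {}" if "x \<notin> K" for x
    proof -
      have "open (- K)" "x \<in> - K" using \<open>closed K\<close> that by auto
      then obtain W where "W \<in> B" "x \<in> W" "W \<subseteq> - K"
        using topological_basisE[OF B(2)] by metis
      then show ?thesis using V by blast
    qed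
    then show ?thesis by blast
  qed
  \<comment> \<open>Three interleaved streams, told apart by the first component of the decoded
    pair: 0 repeats the bit \<open>b\<close>, 1 lists the reals \<open>D n\<close> as sets of
    naturals, and the others list the basic open sets missing \<open>K\<close>.\<close>
  define c where "c = (\<lambda>(b, D, K). {m. case prod_decode m of
      (i, n) \<Rightarrow> if i = 0 then b
        else if i = 1 then (case prod_decode n of (n, m) \<Rightarrow> m \<in> h (D n))
        else V n \<inter> K = {}})"
  have 1: "prod_encode (0, n) \<in> c (b, D, K) \<longleftrightarrow> b"
    and 2: "prod_encode (1, prod_encode (n, m)) \<in> c (b, D, K) \<longleftrightarrow> m \<in> h (D n)"
    and 3: "prod_encode (2, n) \<in> c (b, D, K) \<longleftrightarrow> V n \<inter> K = {}" for n m b D K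
    by (simp_all add: c_def)
  have "inj_on c {(b, D, K). closed K}"
  proof (rule inj_onI, clarsimp)
    fix b b' D D' and K K' :: "(nat \<Rightarrow> real) set"
    assume cl: "closed K" "closed K'" and eq: "c (b, D, K) = c (b', D', K')"
    have "b = b'" using 1[of 0 b D K] 1[of 0 b' D' K'] eq by simp
    moreover have "h (D n) = h (D' n)" for n
      using 2[of n _ b D K] 2[of n _ b' D' K'] eq by blast
    then have "D = D'" using h by (auto simp: inj_def)
    moreover have VK: "V n \<inter> K = {} \<longleftrightarrow> V n \<inter> K' = {}" for n
      using 3[of n b D K] 3[of n b' D' K'] eq by blast
    ultimately have "b = b' \<and> D = D' \<and> (\<forall>n. V n \<inter> K = {} \<longleftrightarrow> V n \<inter> K' = {})" by simp
    moreover have "K = K'"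
      using K_eq[OF cl(1)] K_eq[OF cl(2)] unfolding VK by (rule trans[OF sym])
    ultimately show "b = b' \<and> D = D' \<and> K = K'" by simp
  qed
  then have "inj_on (k \<circ> c) {(b, D, K). closed K}"
    using inj_on_subset[OF k subset_UNIV] by (rule comp_inj_on)
  then show ?thesis by blast
qed

text \<open>An uncountable \<open>A\<close> absorbs the countable factor; a countable one is settled
  by the uncountability of the reals.\<close>

lemma card_Times_nat_ordLess_real:
  assumes "|A| <o |UNIV :: real set|"
  shows "|A \<times> (UNIV :: nat set)| <o |UNIV :: real set|"
proof (cases "countable A")
  case True
  then have "countable (A \<times> (UNIV :: nat set))" by simp
  then have "\<not> |UNIV :: real set| \<le>o |A \<times> (UNIV :: nat set)|"
    by (metis card_of_ordLeq countable_image_inj_on countable_subset uncountable_UNIV_real)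
  then show ?thesis by (simp add: not_ordLeq_iff_ordLess[OF card_of_Well_order card_of_Well_order])
next
  case False
  then have "infinite A" using uncountable_infinite by blast
  moreover have "|UNIV :: nat set| \<le>o |A|"
    using \<open>infinite A\<close> by (simp add: infinite_iff_card_of_nat)
  ultimately have "|A \<times> (UNIV :: nat set)| =o |A|" by (intro card_of_Times_infinite_simps) auto
  then show ?thesis using assms ordIso_ordLess_trans by blast
qed

text \<open>Each request touches countably many rows and columns, so this bounds the ones touched
  before a given stage of the recursion. Enumerating the pieces places the union inside an image of
  \<open>A \<times> UNIV\<close>.\<close>

lemma small_UN_countable:
  assumes "|A| <o |UNIV :: real set|" and "\<And>x. x \<in> A \<Longrightarrow> countable (F x)"
  shows "|\<Union>x\<in>A. F x| <o |UNIV :: real set|"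
proof -
  have "(\<Union>x\<in>A. F x) \<subseteq> (\<lambda>(x, n). from_nat_into (F x) n) ` (A \<times> UNIV)"
  proof
    fix y assume "y \<in> (\<Union>x\<in>A. F x)"
    then obtain x where x: "x \<in> A" "y \<in> F x" by auto
    then obtain n where "y = from_nat_into (F x) n"
      using assms(2) by (metis from_nat_into_surj)
    then show "y \<in> (\<lambda>(x, n). from_nat_into (F x) n) ` (A \<times> UNIV)" using x by force
  qed
  then have "|\<Union>x\<in>A. F x| \<le>o |A \<times> (UNIV :: nat set)|"
    by (meson card_of_image card_of_mono1 ordLeq_transitive)
  then show ?thesis using card_Times_nat_ordLess_real[OF assms(1)] ordLeq_ordLess_trans by blast
qed

lemma ex_outside_small:
  fixes S U :: "real set"
  assumes "|U| <o |UNIV :: real set|" "(UNIV :: real set) \<lesssim> S"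
  obtains x where "x \<in> S" "x \<notin> U"
proof -
  have "\<not> S \<subseteq> U"
  proof
    assume "S \<subseteq> U"
    then have "|UNIV :: real set| \<le>o |U|"
      using assms(2) by (meson card_of_ordLeq lepoll_def lepoll_trans subset_imp_lepoll)
    then show False using assms(1) not_ordLess_ordLeq by blast
  qed
  then show ?thesis using that by blast
qed

text \<open>Row \<open>0\<close> is the identity, so a request for a column can only be met at an
  index that is the zeroth entry of a point of \<open>K\<close>. The projection of \<open>K\<close>
  is compact and the cylinder over it contains \<open>K\<close>, so it meets the unit interval in
  positive measure.\<close>

lemma positive_projection_lepoll:
  assumes K: "compact K" and pos: "emeasure (Pi\<^sub>M (UNIV :: nat set) (\<lambda>_. unif)) K > 0"
  shows "(UNIV :: real set) \<lesssim> {x \<in> {0..1}. \<exists>y\<in>K. y 0 = x}"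
proof -
  let ?N = "Pi\<^sub>M (UNIV :: nat set) (\<lambda>_. unif)"
  define S where "S = (\<lambda>y :: nat \<Rightarrow> real. y 0) ` K"
  have "compact S" unfolding S_def
    by (rule compact_continuous_image[OF continuous_on_subset[OF continuous_on_product_coordinates] K]) simp
  then have [measurable]: "S \<in> sets borel" by (simp add: compact_imp_closed borel_closed)
  have S: "{x \<in> {0..1}. \<exists>y\<in>K. y 0 = x} = {0..1} \<inter> S" by (auto simp: S_def)
  have "emeasure ?N K \<le> emeasure ?N {y \<in> space ?N. y 0 \<in> S}"
    by (rule emeasure_mono[OF _ sets_Collect_single']) (auto simp: S_def[symmetric] space_PiM, auto simp: S_def)
  also have "\<dots> = emeasure unif S"
    by (rule unif_prod.emeasure_PiM_Collect_single) auto
  also have "\<dots> \<le> emeasure lborel ({0..1} \<inter> S)"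
    by (auto simp: emeasure_unif intro!: emeasure_mono)
  finally have "emeasure lborel ({0..1} \<inter> S) > 0" using pos by simp
  moreover have "compact ({0..1} \<inter> S)" using \<open>compact S\<close> by (intro compact_Int) auto
  ultimately show ?thesis unfolding S by (intro positive_measure_compact_lepoll)
qed


section \<open>The recursion that fills the matrix\<close>

type_synonym req = "bool \<times> (nat \<Rightarrow> real) \<times> (nat \<Rightarrow> real) set"

text \<open>A triple \<open>(b, D, K)\<close> asks for a row (if \<open>b\<close>) or for a column with index in \<open>{0..1}\<close>
  (if \<open>\<not> b\<close>) whose entries at the positions \<open>D n\<close> form a sequence in \<open>K\<close>. For columns, position
  \<open>D 0 = 0\<close> carries the prescribed row \<open>0\<close>, so the choice of the column fixes this entry.\<close>

definition requirement :: "req set" where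
  "requirement = {(b, D, K). inj D \<and> compact K \<and>
     emeasure (Pi\<^sub>M (UNIV :: nat set) (\<lambda>_. unif)) K > 0 \<and> (\<not> b \<longrightarrow> D 0 = 0)}"

text \<open>Requests are served along a well-order. Each picks a row or column untouched by its
  fewer than continuum many predecessors and writes a point of its compact set into the cells at the
  positions \<open>D n\<close>. Since these cells are new, no two requests conflict.\<close>

lemma generic_matrix:
  "\<exists>M :: real \<Rightarrow> real \<Rightarrow> real. (\<forall>i. M 0 i = i) \<and>
     (\<forall>D K. inj D \<and> compact K \<and> emeasure (Pi\<^sub>M (UNIV :: nat set) (\<lambda>_. unif)) K > 0
        \<longrightarrow> (\<exists>j. (\<lambda>n. M j (D n)) \<in> K)) \<and>
     (\<forall>D K. inj D \<and> D 0 = 0 \<and> compact K \<and> emeasure (Pi\<^sub>M (UNIV :: nat set) (\<lambda>_. unif)) K > 0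
        \<longrightarrow> (\<exists>i\<in>{0..1}. (\<lambda>n. M (D n) i) \<in> K))"
proof -
  \<comment> \<open>The cardinal of \<open>requirement\<close>, read as a well-order on that set,
    makes every set of predecessors strictly smaller than the whole.\<close>
  define r where "r = |requirement|"
  define before where "before = (\<lambda>x. underS r x)"
  have r: "card_order_on requirement r" unfolding r_def by (rule card_of_card_order_on)
  have Field_r: "Field r = requirement" unfolding r_def by (rule Field_card_of)
  have wo: "Well_order r" unfolding r_def by (rule card_of_Well_order)
  have small: "|before x| <o |UNIV :: real set|" if "x \<in> requirement" for x
  proof -
    have "|before x| <o r"
      unfolding before_def using that Field_r
      by (intro card_of_underS) (simp_all add: r_def card_of_card_order_on)
    also have "r \<le>o |UNIV :: real set|"
    proof -
      obtain g :: "req \<Rightarrow> real"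
        where "inj_on g {(b, D, K). closed K}"
        using inj_on_closed_code by blast
      then have "inj_on g requirement"
        by (rule inj_on_subset) (auto simp: requirement_def compact_imp_closed)
      then show ?thesis unfolding r_def using card_of_ordLeqI by blast
    qed
    finally show ?thesis .
  qed
  have total: "x = y \<or> x \<in> before y \<or> y \<in> before x" if "x \<in> requirement" "y \<in> requirement" for x y
    using wo that unfolding Field_r[symmetric] before_def underS_def
    by (auto simp: well_order_on_def linear_order_on_def total_on_def)
  \<comment> \<open>The row and column indices of the cells that a request occupies once
    \<open>f\<close> has chosen its row or column: one of the two sets is a singleton, the other is
    the range of \<open>D\<close>.\<close>
  define rows where "rows = (\<lambda>(f :: req \<Rightarrow> real) (b, D, K). if b then {f (b, D, K)} else range D)"
  define cols where "cols = (\<lambda>(f :: req \<Rightarrow> real) (b, D, K). if b then range D else {f (b, D, K)})"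
  have countable_lines: "countable (rows f x)" "countable (cols f x)" for f x
    by (auto simp: rows_def cols_def split: prod.splits)
  \<comment> \<open>The admissible choices \<open>l\<close> for \<open>x\<close>. A row must differ
    from row \<open>0\<close>, which is prescribed; a column index must be the zeroth entry of some
    point of \<open>K\<close>. Only the values of \<open>f\<close> before \<open>x\<close> matter,
    as well-founded choice requires.\<close>
  define P where "P = (\<lambda>(f :: req \<Rightarrow> real) x l. x \<in> requirement \<longrightarrow> (case x of (b, D, K) \<Rightarrow>
      if b then l \<in> UNIV - {0} \<and> l \<notin> (\<Union>y\<in>before x. rows f y)
      else l \<in> {x \<in> {0..1}. \<exists>y\<in>K. y 0 = x} \<and> l \<notin> (\<Union>y\<in>before x. cols f y)))"
  have "\<exists>f. \<forall>x. P f x (f x)"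
  proof (rule dependent_wf_choice)
    show "wf (r - Id)" using wo by (simp add: well_order_on_def)
  next
    fix f g :: "req \<Rightarrow> real" and x :: req and l
    assume eq: "\<And>z. (z, x) \<in> r - Id \<Longrightarrow> f z = g z"
    have "rows f y = rows g y \<and> cols f y = cols g y" if "y \<in> before x" for y
      using eq[of y] that by (auto simp: rows_def cols_def before_def underS_def split: prod.splits)
    then show "P f x l = P g x l"
      unfolding P_def by (auto split: prod.splits)
  next
    fix x :: req and f :: "req \<Rightarrow> real"
    obtain b D K where x: "x = (b, D, K)" by (cases x)
    show "\<exists>l. P f x l"
    proof (cases "x \<in> requirement")
      case True
      show ?thesis
      proof (cases b)
        case b: True
        have big: "(UNIV :: real set) \<lesssim> (UNIV - {0} :: real set)"
          by (rule eqpoll_imp_lepoll[OF eqpoll_sym[OF eqpoll_real_subset[of 0 1]]]) auto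
        have "|\<Union>y\<in>before x. rows f y| <o |UNIV :: real set|"
          using small[OF True] countable_lines(1) by (rule small_UN_countable)
        from ex_outside_small[OF this big] obtain l
          where "l \<in> UNIV - {0}" "l \<notin> (\<Union>y\<in>before x. rows f y)"
          .
        then show ?thesis using b x by (auto simp: P_def)
      next
        case b: False
        have big: "(UNIV :: real set) \<lesssim> {x \<in> {0..1}. \<exists>y\<in>K. y 0 = x}"
          using True x by (intro positive_projection_lepoll) (auto simp: requirement_def)
        have "|\<Union>y\<in>before x. cols f y| <o |UNIV :: real set|"
          using small[OF True] countable_lines(2) by (rule small_UN_countable)
        from ex_outside_small[OF this big] obtain l
          where "l \<in> {x \<in> {0..1}. \<exists>y\<in>K. y 0 = x}" "l \<notin> (\<Union>y\<in>before x. cols f y)"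
          .
        then show ?thesis using b x by (intro exI[of _ l]) (auto simp: P_def)
      qed
    qed (auto simp: P_def)
  qed
  then obtain f where f: "\<And>x. P f x (f x)" by blast
  define val where "val = (\<lambda>(b, D :: nat \<Rightarrow> real, K). SOME y. y \<in> K \<and> (\<not> b \<longrightarrow> y 0 = f (b, D, K)))"
  define cell where "cell = (\<lambda>(b, D, K) n. if b then (f (b, D, K), D n) else (D n, f (b, D, K)))"
  have val: "val (b, D, K) \<in> K \<and> (\<not> b \<longrightarrow> val (b, D, K) 0 = f (b, D, K))"
    if "(b, D, K) \<in> requirement" for b D K
  proof -
    have "K \<noteq> {}" using that by (auto simp: requirement_def)
    moreover have "\<not> b \<Longrightarrow> \<exists>y\<in>K. y 0 = f (b, D, K)"
      using f[of "(b, D, K)"] that by (simp add: P_def)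
    ultimately have "\<exists>y. y \<in> K \<and> (\<not> b \<longrightarrow> y 0 = f (b, D, K))" by blast
    from someI_ex[OF this] show ?thesis by (simp add: val_def)
  qed
  have cell_lines: "fst (cell x n) \<in> rows f x" "snd (cell x n) \<in> cols f x" for x n
    by (auto simp: cell_def rows_def cols_def split: prod.splits)
  \<comment> \<open>Every cell of \<open>x\<close> lies in the row or column chosen for
    \<open>x\<close>, and no cell of an earlier request does.\<close>
  have cell_new: "cell y m \<noteq> cell x n"
    if "x \<in> requirement" "y \<in> before x" for x y m n
  proof
    assume eq: "cell y m = cell x n"
    obtain b D K where x: "x = (b, D, K)" by (cases x)
    show False
    proof (cases b)
      case True
      then have "f x \<notin> (\<Union>y\<in>before x. rows f y)" "fst (cell x n) = f x"
        using f[of x] that(1) by (simp_all add: P_def x cell_def)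
      then show False using cell_lines(1)[of y m] that(2) unfolding eq by auto
    next
      case False
      then have "f x \<notin> (\<Union>y\<in>before x. cols f y)" "snd (cell x n) = f x"
        using f[of x] that(1) by (simp_all add: P_def x cell_def)
      then show False using cell_lines(2)[of y m] that(2) unfolding eq by auto
    qed
  qed
  have cell_inj: "x = y \<and> n = m"
    if "cell x n = cell y m" "x \<in> requirement" "y \<in> requirement" for x y n m
  proof -
    have "x = y" using total[OF that(2,3)] cell_new that by metis
    moreover have "n = m"
      using that unfolding \<open>x = y\<close>
      by (auto simp: cell_def requirement_def inj_def split: prod.splits if_splits)
    ultimately show ?thesis by simp
  qed
  \<comment> \<open>Row \<open>0\<close> overrides the recursion. It is touched only by column
    requests at \<open>n = 0\<close>, where \<open>val\<close> has the column index as its entry, so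
    the override is consistent. Cells that no request occupies get the arbitrary value 0.\<close>
  define M where "M j i = (if j = 0 then i
    else if \<exists>x n. x \<in> requirement \<and> cell x n = (j, i)
      then (THE v. \<exists>x n. x \<in> requirement \<and> cell x n = (j, i) \<and> v = val x n) else 0)" for j i
  have M_cell: "M j i = val x n" if "x \<in> requirement" "cell x n = (j, i)" "j \<noteq> 0" for x n j i
  proof -
    have "(THE v. \<exists>x n. x \<in> requirement \<and> cell x n = (j, i) \<and> v = val x n) = val x n"
      using that cell_inj by (intro the_equality) (blast, metis)
    moreover have "\<exists>x n. x \<in> requirement \<and> cell x n = (j, i)" using that by blast
    ultimately show ?thesis using that(3) unfolding M_def by presburger
  qed
  have 1: "\<exists>j. (\<lambda>n. M j (D n)) \<in> K"
    if "inj D" "compact K" "emeasure (Pi\<^sub>M (UNIV :: nat set) (\<lambda>_. unif)) K > 0" for D K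
  proof -
    have x: "(True, D, K) \<in> requirement" using that by (auto simp: requirement_def)
    have "f (True, D, K) \<noteq> 0" using f[of "(True, D, K)"] x by (auto simp: P_def)
    then have "M (f (True, D, K)) (D n) = val (True, D, K) n" for n
      using x by (intro M_cell) (auto simp: cell_def)
    then show ?thesis using val[OF x] by (intro exI[of _ "f (True, D, K)"]) auto
  qed
  have 2: "\<exists>i\<in>{0..1}. (\<lambda>n. M (D n) i) \<in> K"
    if "inj D" "D 0 = 0" "compact K" "emeasure (Pi\<^sub>M (UNIV :: nat set) (\<lambda>_. unif)) K > 0" for D K
  proof -
    have x: "(False, D, K) \<in> requirement" using that by (auto simp: requirement_def)
    have i: "f (False, D, K) \<in> {0..1}" using f[of "(False, D, K)"] x by (auto simp: P_def)
    have "M (D n) (f (False, D, K)) = val (False, D, K) n" for n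
    proof (cases "n = 0")
      case True
      then show ?thesis using val[OF x] \<open>D 0 = 0\<close> by (simp add: M_def)
    next
      case False
      then have "D n \<noteq> 0" using \<open>inj D\<close> \<open>D 0 = 0\<close> by (metis injD)
      then show ?thesis using x by (intro M_cell) (auto simp: cell_def)
    qed
    then show ?thesis using val[OF x] i by (intro bexI[of _ "f (False, D, K)"]) auto
  qed
  show ?thesis
    by (intro exI[of _ M] conjI allI impI) (use 1 2 in \<open>auto simp: M_def\<close>)
qed

section \<open>Measures pulled back along generic maps\<close>

text \<open>Since \<open>T\<close> meets every set of positive measure, two measurable sets with the
  same preimage differ by a null set. The measure of a preimage is therefore well defined, even if
  the range of \<open>T\<close> is not measurable.\<close>

lemma ex_pullback_measure:
  fixes N :: "'b measure" and T :: "'a \<Rightarrow> 'b"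
  assumes T: "T \<in> S \<rightarrow> space N"
    and full: "\<And>A. A \<in> sets N \<Longrightarrow> emeasure N A > 0 \<Longrightarrow> \<exists>x\<in>S. T x \<in> A"
  shows "\<exists>M. space M = S \<and> sets M = {T -` A \<inter> S |A. A \<in> sets N} \<and>
    T \<in> M \<rightarrow>\<^sub>M N \<and> distr M N T = N"
proof -
  define \<mu> where "\<mu> B = emeasure N (SOME A. A \<in> sets N \<and> B = T -` A \<inter> S)" for B
  have diff: "emeasure N (A - A') = 0"
    if "A \<in> sets N" "A' \<in> sets N" "T -` A \<inter> S = T -` A' \<inter> S" for A A'
    using full[of "A - A'"] that by (auto simp: zero_less_iff_neq_zero)
  have eq: "emeasure N A = emeasure N A'"
    if "A \<in> sets N" "A' \<in> sets N" "T -` A \<inter> S = T -` A' \<inter> S" for A A'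
  proof (rule emeasure_eq_AE)
    have "A - A' \<in> null_sets N" "A' - A \<in> null_sets N"
      using diff[of A A'] diff[of A' A] that by (auto intro!: null_setsI)
    then have "AE x in N. x \<notin> A - A'" "AE x in N. x \<notin> A' - A" by (simp_all only: AE_not_in)
    then show "AE x in N. x \<in> A \<longleftrightarrow> x \<in> A'" by eventually_elim auto
  qed (use that in auto)
  have \<mu>: "\<mu> (T -` A \<inter> S) = emeasure N A" if "A \<in> sets N" for A
  proof -
    define A' where "A' = (SOME A'. A' \<in> sets N \<and> T -` A \<inter> S = T -` A' \<inter> S)"
    have "A' \<in> sets N \<and> T -` A \<inter> S = T -` A' \<inter> S"
      unfolding A'_def by (rule someI[of _ A]) (use that in auto)
    then have "emeasure N A = emeasure N A'" using that by (intro eq) auto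
    then show ?thesis unfolding \<mu>_def A'_def ..
  qed
  define M where "M = measure_of S {T -` A \<inter> S |A. A \<in> sets N} \<mu>"
  have sets_eq: "sigma_sets S {T -` A \<inter> S |A. A \<in> sets N} = {T -` A \<inter> S |A. A \<in> sets N}"
    using sets_vimage_algebra2[OF T] sets.sigma_sets_eq[of "vimage_algebra S T N"] by simp
  have sets_M: "sets M = {T -` A \<inter> S |A. A \<in> sets N}"
    unfolding M_def by (subst sets_measure_of) (auto simp: sets_eq)
  have space_M: "space M = S"
    unfolding M_def by (rule space_measure_of) auto
  have em: "emeasure M (T -` A \<inter> S) = emeasure N A" if "A \<in> sets N" for A
  proof -
    have "emeasure M (T -` A \<inter> S) = \<mu> (T -` A \<inter> S)"
    proof (rule emeasure_measure_of[OF M_def])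
      show "positive (sets M) \<mu>"
        using \<mu>[of "{}"] by (simp add: positive_def)
      show "countably_additive (sets M) \<mu>"
      proof (rule countably_additiveI)
        fix B :: "nat \<Rightarrow> 'a set"
        assume B: "range B \<subseteq> sets M" "disjoint_family B"
        then have "\<forall>n. \<exists>A. A \<in> sets N \<and> B n = T -` A \<inter> S" unfolding sets_M by blast
        then obtain A where A: "\<And>n. A n \<in> sets N" "\<And>n. B n = T -` A n \<inter> S" by metis
        \<comment> \<open>Disjoint preimages can come from overlapping sets \<open>A n\<close>.
          Passing to \<open>disjointed A\<close> removes the overlaps without changing the
          preimages.\<close>
        have B': "B n = T -` disjointed A n \<inter> S" for n
        proof -
          have "B n \<inter> B m = {}" if "m \<noteq> n" for m
            using B(2) that by (auto simp: disjoint_family_on_def)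
          then show ?thesis
            unfolding A(2) disjointed_def by (fastforce simp: A(2))
        qed
        have meas: "disjointed A n \<in> sets N" for n
          using A(1) sets.range_disjointed_sets[of A N] by auto
        have "(\<Sum>n. \<mu> (B n)) = (\<Sum>n. emeasure N (disjointed A n))"
          unfolding B' using \<mu>[OF meas] by simp
        also have "\<dots> = emeasure N (\<Union>n. disjointed A n)"
          using meas by (intro suminf_emeasure) (auto simp: disjoint_family_disjointed)
        also have "\<dots> = \<mu> (T -` (\<Union>n. disjointed A n) \<inter> S)"
          using meas by (intro \<mu>[symmetric]) auto
        also have "T -` (\<Union>n. disjointed A n) \<inter> S = (\<Union>n. B n)"
          using B' by auto
        finally show "(\<Sum>n. \<mu> (B n)) = \<mu> (\<Union>n. B n)" .
      qed
    qed (use that in \<open>auto simp: sets_M\<close>)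
    then show ?thesis using \<mu>[OF that] by simp
  qed
  have meas: "T \<in> M \<rightarrow>\<^sub>M N"
    using T by (intro measurableI) (auto simp: space_M sets_M)
  moreover have "distr M N T = N"
    using meas by (intro measure_eqI) (auto simp: emeasure_distr space_M em)
  ultimately show ?thesis using space_M sets_M by blast
qed

text \<open>An event depends on countably many coordinates. Listing them as a sequence turns it into
  a Borel set of the Polish space of real sequences, where inner regularity supplies the compact
  set.\<close>

lemma ex_compact_cylinder:
  assumes A: "A \<in> sets (Pi\<^sub>M (UNIV :: real set) (\<lambda>_. unif))"
    and pos: "emeasure (Pi\<^sub>M (UNIV :: real set) (\<lambda>_. unif)) A > 0"
  obtains D :: "nat \<Rightarrow> real" and K where "inj D" "D 0 = 0" "compact K"
    "emeasure (Pi\<^sub>M (UNIV :: nat set) (\<lambda>_. unif)) K > 0"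
    "\<And>\<omega>. (\<lambda>n. \<omega> (D n)) \<in> K \<Longrightarrow> \<omega> \<in> A"
proof -
  let ?N = "Pi\<^sub>M (UNIV :: real set) (\<lambda>_. unif)"
  let ?N' = "Pi\<^sub>M (UNIV :: nat set) (\<lambda>_. unif)"
  obtain J X where J: "countable J" and X: "X \<in> sets (Pi\<^sub>M J (\<lambda>_. unif))"
    and A_eq: "A = prod_emb UNIV (\<lambda>_. unif) J X"
    using sets_PiM_D_countable[OF A] by auto
  \<comment> \<open>Adding \<open>range real\<close> makes the index set infinite, so its
    enumeration is injective; removing \<open>0\<close> frees this coordinate to be position 0 of
    \<open>D\<close>, as requests for columns demand.\<close>
  define J' where "J' = J \<union> range real - {0}"
  have J': "countable J'" "infinite J'"
  proof -
    show "countable J'" using J by (simp add: J'_def)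
    have "infinite (range real)" by (simp add: finite_image_iff inj_of_nat)
    then show "infinite J'" by (simp add: J'_def)
  qed
  define D where "D n = (case n of 0 \<Rightarrow> 0 | Suc m \<Rightarrow> from_nat_into J' m)" for n
  have bij: "bij_betw (from_nat_into J') UNIV J'"
    using J' by (rule bij_betw_from_nat_into)
  have "0 \<notin> J'" by (simp add: J'_def)
  then have "from_nat_into J' m \<noteq> 0" for m
    using bij by (metis UNIV_I bij_betwE)
  then have inj: "inj D"
    using bij_betw_imp_inj_on[OF bij] by (auto simp: inj_def D_def split: nat.splits)
  have "J \<subseteq> insert 0 J'" by (auto simp: J'_def)
  also have "J' = from_nat_into J' ` UNIV" using bij by (simp add: bij_betw_def)
  then have "insert 0 J' \<subseteq> range D"
  proof -
    have "D 0 = 0" "from_nat_into J' m = D (Suc m)" for m by (simp_all add: D_def)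
    then show ?thesis using \<open>J' = from_nat_into J' ` UNIV\<close> by (metis (no_types, lifting) imageE insertE rangeI subsetI)
  qed
  finally have J_D: "J \<subseteq> range D" .
  \<comment> \<open>\<open>g\<close> reads the coordinates in \<open>J\<close> back from the
    sequence, through \<open>inv D\<close>.\<close>
  define g where "g x = (\<lambda>j\<in>J. x (inv D j) :: real)" for x
  have g: "g \<in> ?N' \<rightarrow>\<^sub>M Pi\<^sub>M J (\<lambda>_. unif)" unfolding g_def by measurable
  have g_D: "g (\<lambda>n. \<omega> (D n)) = restrict \<omega> J" for \<omega>
  proof
    fix j show "g (\<lambda>n. \<omega> (D n)) j = restrict \<omega> J j"
      using J_D by (auto simp: g_def f_inv_into_f)
  qed
  define B where "B = g -` X \<inter> space ?N'"
  have B: "B \<in> sets ?N'" unfolding B_def using g X by (rule measurable_sets)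
  have mem: "\<omega> \<in> A \<longleftrightarrow> (\<lambda>n. \<omega> (D n)) \<in> B" for \<omega>
    by (auto simp: A_eq B_def prod_emb_def g_D space_PiM)
  have D_meas: "(\<lambda>\<omega> n. \<omega> (D n)) \<in> ?N \<rightarrow>\<^sub>M ?N'" by (intro measurable_PiM_single') auto
  have "distr ?N ?N' (\<lambda>\<omega>. \<lambda>n\<in>UNIV. \<omega> (D n)) = ?N'"
    using inj unif.prob_space_axioms by (intro distr_PiM_reindex) auto
  then have distr_D: "distr ?N ?N' (\<lambda>\<omega> n. \<omega> (D n)) = ?N'" by (simp add: restrict_def)
  have "emeasure ?N' B = emeasure (distr ?N ?N' (\<lambda>\<omega> n. \<omega> (D n))) B" by (simp only: distr_D)
  also have "\<dots> = emeasure ?N A"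
    using B D_meas by (subst emeasure_distr) (auto simp: mem space_PiM intro!: arg_cong[where f="emeasure _"])
  finally have "emeasure ?N' B > 0" using pos by simp
  moreover have "emeasure ?N' B = (SUP K \<in> {K. K \<subseteq> B \<and> compact K}. emeasure ?N' K)"
    using B sets_borel_seq prob_space.emeasure_space_1[OF prob_space_PiM[of UNIV "\<lambda>_. unif"]] unif.prob_space_axioms
    by (intro inner_regular) auto
  ultimately obtain K where "K \<subseteq> B" "compact K" "emeasure ?N' K > 0"
    by (auto simp: less_SUP_iff)
  then show ?thesis using that[of D K] inj mem by (auto simp: D_def)
qed

section \<open>Independence of all but countably many coordinates\<close>

text \<open>A Dynkin class argument. For a box with finitely many restricted sides, \<open>D\<close>
  consists of these sides; complements keep \<open>D\<close>, and disjoint unions take the countable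
  union of the exceptional sets.\<close>

lemma coordinate_indep_PiM:
  fixes N :: "('k \<Rightarrow> real) measure"
  defines "N \<equiv> Pi\<^sub>M UNIV (\<lambda>_. unif)"
  assumes "A \<in> sets N"
  shows "\<exists>D. countable D \<and> (\<forall>k. k \<notin> D \<longrightarrow> (\<forall>C\<in>sets borel.
    emeasure N {\<omega>\<in>A. \<omega> k \<in> C} = emeasure N A * emeasure unif C))"
proof -
  interpret N: prob_space N unfolding N_def by (intro prob_space_PiM unif.prob_space_axioms)
  let ?G = "{(\<Pi>\<^sub>E i\<in>(UNIV :: 'k set). X i) |X. (\<forall>i. X i \<in> sets unif) \<and> finite {i. X i \<noteq> space unif}}"
  have space_N: "space N = UNIV" by (simp add: N_def space_PiM)
  have sets_N: "sets N = sigma_sets UNIV ?G"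
    unfolding N_def by (subst sets_PiM_finite) simp
  have coord: "{\<omega>. \<omega> k \<in> C} \<in> sets N" if "C \<in> sets borel" for k C
    using sets_Collect_single'[of k UNIV "\<lambda>_. unif" "\<lambda>x. x \<in> C"] that
    by (simp add: N_def space_PiM)
  have split: "{\<omega>\<in>A. \<omega> k \<in> C} = A \<inter> {\<omega>. \<omega> k \<in> C}" for A :: "('k \<Rightarrow> real) set" and k C by auto
  have "Int_stable ?G"
  proof (rule Int_stableI)
    fix a b assume "a \<in> ?G" "b \<in> ?G"
    then obtain X Y where XY: "a = Pi UNIV X" "b = Pi UNIV Y"
      "\<And>i. X i \<in> sets borel" "finite {i. X i \<noteq> UNIV}" "\<And>i. Y i \<in> sets borel" "finite {i. Y i \<noteq> UNIV}"
      by (auto simp: PiE_UNIV_domain)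
    have "finite {i. X i \<inter> Y i \<noteq> UNIV}"
      by (rule finite_subset[of _ "{i. X i \<noteq> UNIV} \<union> {i. Y i \<noteq> UNIV}"]) (use XY in auto)
    moreover have "a \<inter> b = (\<Pi>\<^sub>E i\<in>UNIV. X i \<inter> Y i)" by (auto simp: XY)
    ultimately show "a \<inter> b \<in> ?G" using XY by (auto intro!: exI[of _ "\<lambda>i. X i \<inter> Y i"])
  qed
  moreover have "?G \<subseteq> Pow UNIV" by simp
  moreover have "A \<in> sigma_sets UNIV ?G" using assms sets_N by simp
  ultimately show ?thesis
  proof (induction rule: sigma_sets_induct_disjoint)
    case (basic A)
    then obtain X where X: "A = Pi UNIV X" "\<And>i. X i \<in> sets borel" "finite {i. X i \<noteq> UNIV}"
      by (auto simp: PiE_UNIV_domain)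
    define J where "J = {i. X i \<noteq> UNIV}"
    have A: "A = {\<omega> \<in> space N. \<forall>i\<in>J. \<omega> i \<in> X i}" by (auto simp: X J_def space_N)
    show ?case
    proof (intro exI[of _ J] conjI allI impI ballI)
      show "countable J" using X by (simp add: J_def countable_finite)
      fix k C assume k: "k \<notin> J" and C: "C \<in> sets (borel :: real measure)"
      \<comment> \<open>As \<open>k\<close> is unrestricted in the box, cutting by \<open>C\<close>
        adds a single factor to the product.\<close>
      define Y where "Y = X(k := C)"
      have "{\<omega>\<in>A. \<omega> k \<in> C} = {\<omega> \<in> space N. \<forall>i\<in>insert k J. \<omega> i \<in> Y i}"
        using k by (auto simp: A Y_def)
      also have "emeasure N \<dots> = (\<Prod>i\<in>insert k J. emeasure unif (Y i))"
        unfolding N_def using X C by (intro unif_prod.emeasure_PiM_Collect) (auto simp: J_def Y_def)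
      also have "\<dots> = emeasure unif C * (\<Prod>i\<in>J. emeasure unif (Y i))"
        using k X(3) by (subst prod.insert) (auto simp: Y_def J_def)
      also have "(\<Prod>i\<in>J. emeasure unif (Y i)) = (\<Prod>i\<in>J. emeasure unif (X i))"
        using k by (intro prod.cong) (auto simp: Y_def)
      also have "\<dots> = emeasure N A"
        unfolding N_def A using X by (intro unif_prod.emeasure_PiM_Collect[symmetric]) (auto simp: J_def N_def)
      finally show "emeasure N {\<omega>\<in>A. \<omega> k \<in> C} = emeasure N A * emeasure unif C"
        by (simp add: mult.commute)
    qed
  next
    case empty
    show ?case by (intro exI[of _ "{}"]) auto
  next
    case (compl A)
    then obtain D where D: "countable D" "\<And>k C. k \<notin> D \<Longrightarrow> C \<in> sets borel \<Longrightarrow>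
      emeasure N {\<omega>\<in>A. \<omega> k \<in> C} = emeasure N A * emeasure unif C" by blast
    have A: "A \<in> sets N" using compl sets_N by simp
    have "emeasure N {\<omega> \<in> UNIV - A. \<omega> k \<in> C} = emeasure N (UNIV - A) * emeasure unif C"
      if "k \<notin> D" "C \<in> sets borel" for k C
    proof -
      have "{\<omega> \<in> UNIV - A. \<omega> k \<in> C} = {\<omega>. \<omega> k \<in> C} - {\<omega>\<in>A. \<omega> k \<in> C}" by auto
      also have "emeasure N \<dots> = emeasure N {\<omega>. \<omega> k \<in> C} - emeasure N {\<omega>\<in>A. \<omega> k \<in> C}"
        using A coord[OF that(2)] by (intro emeasure_Diff) (auto simp: split)
      also have "emeasure N {\<omega>. \<omega> k \<in> C} = emeasure unif C"
        using unif_prod.emeasure_PiM_Collect_single[of k C] that by (simp add: N_def space_PiM)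
      also have "emeasure unif C - emeasure N {\<omega>\<in>A. \<omega> k \<in> C} = (1 - emeasure N A) * emeasure unif C"
        using D(2)[OF that] by (simp add: ennreal_right_diff_distrib mult.commute unif.emeasure_eq_measure)
      also have "1 - emeasure N A = emeasure N (UNIV - A)"
        using emeasure_compl[OF A] N.emeasure_space_1 by (simp add: space_N)
      finally show ?thesis .
    qed
    then show ?case using D(1) by blast
  next
    case (union A)
    have "\<forall>n::nat. \<exists>D. countable D \<and> (\<forall>k. k \<notin> D \<longrightarrow> (\<forall>C\<in>sets borel.
      emeasure N {\<omega>\<in>A n. \<omega> k \<in> C} = emeasure N (A n) * emeasure unif C))" by (rule allI) (rule union(3))
    from choice[OF this] obtain D where D': "\<forall>n. countable (D n) \<and> (\<forall>k. k \<notin> D n \<longrightarrow> (\<forall>C\<in>sets borel.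
      emeasure N {\<omega>\<in>A n. \<omega> k \<in> C} = emeasure N (A n) * emeasure unif C))" ..
    then have D: "countable (D n)" "k \<notin> D n \<Longrightarrow> C \<in> sets borel \<Longrightarrow>
      emeasure N {\<omega>\<in>A n. \<omega> k \<in> C} = emeasure N (A n) * emeasure unif C" for n k C by simp_all
    have A: "A n \<in> sets N" for n using union(2) unfolding sets_N by (rule subsetD) simp
    have "emeasure N {\<omega> \<in> \<Union>n. A n. \<omega> k \<in> C} = emeasure N (\<Union>n. A n) * emeasure unif C"
      if k: "k \<notin> (\<Union>n. D n)" "C \<in> sets borel" for k C
    proof -
      have "{\<omega> \<in> \<Union>n. A n. \<omega> k \<in> C} = (\<Union>n. {\<omega>\<in>A n. \<omega> k \<in> C})" by auto
      also have "emeasure N \<dots> = (\<Sum>n. emeasure N {\<omega>\<in>A n. \<omega> k \<in> C})"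
        using union(1) A coord[OF k(2)]
        by (intro suminf_emeasure[symmetric]) (auto simp: split disjoint_family_on_def)
      also have "\<dots> = (\<Sum>n. emeasure N (A n) * emeasure unif C)" using D(2) k by auto
      also have "\<dots> = emeasure N (\<Union>n. A n) * emeasure unif C"
        using union(1) A by (simp add: suminf_emeasure[symmetric] image_subset_iff)
      finally show ?thesis .
    qed
    then show ?case using D(1) by (intro exI[of _ "\<Union>n. D n"]) auto
  qed
qed

text \<open>A set of the completion differs by a null set from the preimage of some event
  \<open>B\<close>, and it inherits the exceptional set of \<open>B\<close>.\<close>

lemma coordinate_indep_completion:
  fixes T :: "'a \<Rightarrow> 'k \<Rightarrow> real"
  assumes sets_Q: "sets Q = {T -` A \<inter> space Q |A. A \<in> sets (Pi\<^sub>M UNIV (\<lambda>_. unif))}"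
    and T: "T \<in> Q \<rightarrow>\<^sub>M Pi\<^sub>M UNIV (\<lambda>_. unif)"
    and distr: "distr Q (Pi\<^sub>M UNIV (\<lambda>_. unif)) T = Pi\<^sub>M UNIV (\<lambda>_. unif)"
    and A: "A \<in> sets (completion Q)"
  shows "\<exists>D. countable D \<and> (\<forall>k. k \<notin> D \<longrightarrow> (\<forall>C\<in>sets borel.
    emeasure (completion Q) {x\<in>A. T x k \<in> C} = emeasure (completion Q) A * emeasure unif C))"
proof -
  let ?N = "Pi\<^sub>M (UNIV :: 'k set) (\<lambda>_. unif)"
  obtain S N' N where S: "A = S \<union> N" "N \<subseteq> N'" "N' \<in> null_sets Q" "S \<in> sets Q"
    using A by (rule sets_completionE)
  have "S \<in> {T -` A \<inter> space Q |A. A \<in> sets ?N}" using S(4) unfolding sets_Q .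
  then obtain B where B: "S = T -` B \<inter> space Q" "B \<in> sets ?N" by blast
  obtain D where D: "countable D" "\<And>k C. k \<notin> D \<Longrightarrow> C \<in> sets borel \<Longrightarrow>
      emeasure ?N {\<omega>\<in>B. \<omega> k \<in> C} = emeasure ?N B * emeasure unif C"
    using coordinate_indep_PiM[OF B(2)] by blast
  have em: "emeasure (completion Q) (T -` B \<inter> space Q) = emeasure ?N B" if "B \<in> sets ?N" for B
    using that T by (subst distr[symmetric]) (simp add: emeasure_distr)
  have Tk: "{x \<in> space Q. T x k \<in> C} \<in> sets Q" if "C \<in> sets borel" for k C
  proof -
    have "(\<lambda>x. T x k) \<in> Q \<rightarrow>\<^sub>M unif"
      by (rule measurable_compose[OF T measurable_component_singleton]) simp
    then have "(\<lambda>x. T x k) \<in> borel_measurable Q" by (simp add: measurable_cong_sets[OF refl sets_unif])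
    then show ?thesis using that by measurable
  qed
  have ae: "AE x in completion Q. x \<notin> N'"
    using S(3) by (intro AE_completion AE_not_in)
  have "emeasure (completion Q) {x\<in>A. T x k \<in> C} = emeasure (completion Q) A * emeasure unif C"
    if k: "k \<notin> D" and C: "C \<in> sets borel" for k C
  proof -
    have A_sub: "A \<subseteq> space Q" using sets.sets_into_space[OF A] by simp
    have Bk: "{\<omega>\<in>B. \<omega> k \<in> C} \<in> sets ?N"
    proof -
      have "{\<omega> \<in> space ?N. \<omega> k \<in> C} \<in> sets ?N" using C by (intro sets_Collect_single') auto
      then have "B \<inter> {\<omega> \<in> space ?N. \<omega> k \<in> C} \<in> sets ?N" using B(2) by auto
      also have "B \<inter> {\<omega> \<in> space ?N. \<omega> k \<in> C} = {\<omega>\<in>B. \<omega> k \<in> C}" by (auto simp: space_PiM)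
      finally show ?thesis .
    qed
    have "{x\<in>A. T x k \<in> C} = A \<inter> {x \<in> space Q. T x k \<in> C}" using A_sub by auto
    then have meas: "{x\<in>A. T x k \<in> C} \<in> sets (completion Q)" using A Tk[OF C] by auto
    have "emeasure (completion Q) {x\<in>A. T x k \<in> C} =
        emeasure (completion Q) (T -` {\<omega>\<in>B. \<omega> k \<in> C} \<inter> space Q)"
    proof (rule emeasure_eq_AE)
      show "AE x in completion Q. x \<in> {x\<in>A. T x k \<in> C} \<longleftrightarrow> x \<in> T -` {\<omega>\<in>B. \<omega> k \<in> C} \<inter> space Q"
        using ae by eventually_elim (use S(1,2) A_sub B(1) in blast)
    qed (use meas measurable_sets[OF T Bk] in auto)
    also have "\<dots> = emeasure ?N {\<omega>\<in>B. \<omega> k \<in> C}" by (rule em[OF Bk])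
    also have "\<dots> = emeasure ?N B * emeasure unif C" by (rule D(2)[OF k C])
    also have "emeasure ?N B = emeasure (completion Q) (T -` B \<inter> space Q)"
      by (rule em[symmetric, OF B(2)])
    also have "\<dots> = emeasure (completion Q) A"
    proof (rule emeasure_eq_AE)
      show "AE x in completion Q. x \<in> T -` B \<inter> space Q \<longleftrightarrow> x \<in> A"
        using ae by eventually_elim (use S(1,2) A_sub B(1) in blast)
    qed (use A measurable_sets[OF T B(2)] in auto)
    finally show ?thesis .
  qed
  then show ?thesis using D(1) by blast
qed

text \<open>Serves the index space, with \<open>T\<close> sending an index to its column, and the
  sample space, with \<open>T\<close> sending a point to its row. Pulling back the product measure
  makes the coordinates of \<open>T\<close> uniform and pairwise independent; the completion lets
  measurability pass between functions that agree almost everywhere.\<close>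

lemma ex_generic_space:
  fixes T :: "'a \<Rightarrow> 'k \<Rightarrow> real"
  assumes full: "\<And>A. A \<in> sets (Pi\<^sub>M UNIV (\<lambda>_. unif)) \<Longrightarrow> emeasure (Pi\<^sub>M UNIV (\<lambda>_. unif)) A > 0
    \<Longrightarrow> \<exists>x\<in>S. T x \<in> A"
  obtains Q where "prob_space Q" "complete_measure Q" "space Q = S"
    "\<And>k. (\<lambda>x. T x k) \<in> Q \<rightarrow>\<^sub>M unif" "\<And>k. distr Q unif (\<lambda>x. T x k) = unif"
    "\<And>k l. k \<noteq> l \<Longrightarrow> prob_space.indep_var Q unif (\<lambda>x. T x k) unif (\<lambda>x. T x l)"
    "\<And>A. A \<in> sets Q \<Longrightarrow> \<exists>D. countable D \<and> (\<forall>k. k \<notin> D \<longrightarrow> (\<forall>C\<in>sets borel.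
      emeasure Q {x\<in>A. T x k \<in> C} = emeasure Q A * emeasure unif C))"
proof -
  let ?N = "Pi\<^sub>M (UNIV :: 'k set) (\<lambda>_. unif)"
  have "T \<in> S \<rightarrow> space ?N" by (simp add: space_PiM)
  from ex_pullback_measure[OF this full] obtain Q where Q: "space Q = S" "sets Q = {T -` A \<inter> S |A. A \<in> sets ?N}"
      "T \<in> Q \<rightarrow>\<^sub>M ?N" "distr Q ?N T = ?N"
    by blast
  have prob_N: "prob_space ?N" by (rule prob_space_PiM) (rule unif.prob_space_axioms)
  have "prob_space Q" using prob_space_distrD[OF Q(3)] prob_N by (simp add: Q(4))
  then have prob: "prob_space (completion Q)"
    by (intro prob_spaceI) (simp add: prob_space.emeasure_space_1)
  then interpret C: prob_space "completion Q" .
  have T: "T \<in> completion Q \<rightarrow>\<^sub>M ?N" by (rule measurable_completion[OF Q(3)])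
  have distr_T: "distr (completion Q) ?N T = ?N" by (simp add: distr_completion Q)
  have Tk: "(\<lambda>x. T x k) \<in> completion Q \<rightarrow>\<^sub>M unif" for k
    by (rule measurable_compose[OF T measurable_component_singleton]) simp
  have distr_Tk: "distr (completion Q) unif (\<lambda>x. T x k) = unif" for k
  proof -
    have "distr (completion Q) unif (\<lambda>x. T x k) = distr (distr (completion Q) ?N T) unif (\<lambda>\<omega>. \<omega> k)"
      using T by (subst distr_distr) (auto simp: comp_def)
    also have "\<dots> = unif"
      unfolding distr_T using distr_PiM_component[of UNIV "\<lambda>_. unif" k] unif.prob_space_axioms by simp
    finally show ?thesis .
  qed
  have indep: "C.indep_var unif (\<lambda>x. T x k) unif (\<lambda>x. T x l)" if "k \<noteq> l" for k l
    unfolding C.indep_var_distribution_eq distr_Tk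
  proof (intro conjI Tk)
    show "unif \<Otimes>\<^sub>M unif = distr (completion Q) (unif \<Otimes>\<^sub>M unif) (\<lambda>x. (T x k, T x l))"
    proof (rule pair_measure_eqI)
      fix A B assume AB: "A \<in> sets unif" "B \<in> sets unif"
      \<comment> \<open>A box with side \<open>A\<close> at \<open>k\<close>; the value
        \<open>B\<close> at the other coordinates enters only at \<open>l\<close>.\<close>
      define X where "X = (\<lambda>_. B)(k := A)"
      have [measurable]: "(\<lambda>x. (T x k, T x l)) \<in> completion Q \<rightarrow>\<^sub>M unif \<Otimes>\<^sub>M unif"
        by (rule measurable_Pair[OF Tk Tk])
      have "emeasure unif A * emeasure unif B = (\<Prod>j\<in>{k, l}. emeasure unif (X j))"
        using that by (simp add: X_def)
      also have "\<dots> = emeasure ?N {\<omega> \<in> space ?N. \<forall>j\<in>{k, l}. \<omega> j \<in> X j}"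
        using AB by (intro unif_prod.emeasure_PiM_Collect[symmetric]) (auto simp: X_def)
      also have "\<dots> = emeasure (distr (completion Q) ?N T) {\<omega> \<in> space ?N. \<forall>j\<in>{k, l}. \<omega> j \<in> X j}"
        by (simp only: distr_T)
      also have "\<dots> = emeasure (completion Q) ((\<lambda>x. (T x k, T x l)) -` (A \<times> B) \<inter> space (completion Q))"
      proof (subst emeasure_distr[OF T])
        have "{\<omega> \<in> space ?N. \<forall>j\<in>{k, l}. \<omega> j \<in> X j} =
            {\<omega> \<in> space ?N. \<omega> k \<in> A} \<inter> {\<omega> \<in> space ?N. \<omega> l \<in> B}"
          using that by (auto simp: X_def)
        also have "\<dots> \<in> sets ?N" using AB by (intro sets.Int sets_Collect_single') auto
        finally show "{\<omega> \<in> space ?N. \<forall>j\<in>{k, l}. \<omega> j \<in> X j} \<in> sets ?N" .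
      qed (use that in \<open>auto simp: X_def space_PiM intro!: arg_cong[where f = "emeasure (completion Q)"]\<close>)
      also have "\<dots> = emeasure (distr (completion Q) (unif \<Otimes>\<^sub>M unif) (\<lambda>x. (T x k, T x l))) (A \<times> B)"
        using AB by (subst emeasure_distr) auto
      finally show "emeasure unif A * emeasure unif B =
        emeasure (distr (completion Q) (unif \<Otimes>\<^sub>M unif) (\<lambda>x. (T x k, T x l))) (A \<times> B)" .
    qed (simp_all add: unif.sigma_finite_measure_axioms)
  qed
  have sets_Q: "sets Q = {T -` A \<inter> space Q |A. A \<in> sets ?N}" by (simp only: Q(1,2))
  show ?thesis
    by (rule that[OF prob _ _ Tk distr_Tk indep coordinate_indep_completion[OF sets_Q Q(3,4)]])
       (simp_all add: Q(1) completion.complete_measure_axioms)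
qed

section \<open>Measures given by their sections\<close>

text \<open>Preimages under the two maps differ only within a null set. This makes section integrals
  measurable although sections are controlled only at almost all indices.\<close>

lemma (in complete_measure) measurable_cong_AE:
  assumes f: "f \<in> M \<rightarrow>\<^sub>M N" and ae: "AE x in M. f x = g x" and g: "\<And>x. x \<in> space M \<Longrightarrow> g x \<in> space N"
  shows "g \<in> M \<rightarrow>\<^sub>M N"
proof (rule measurableI)
  fix A assume A: "A \<in> sets N"
  have "AE x in M. x \<in> f -` A \<inter> space M \<longleftrightarrow> x \<in> g -` A \<inter> space M"
    using ae by eventually_elim auto
  then show "g -` A \<inter> space M \<in> sets M"
    by (rule in_sets_AE[OF _ measurable_sets[OF f A]]) simp
qed (rule g)

text \<open>The map \<open>s i\<close> carries the fibre \<open>P\<close> over the index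
  \<open>i\<close> into \<open>\<Omega>\<close>. Leaving it abstract treats both orders of
  integration at once: \<open>Pair\<close> for the one, the swapped pairing for the other.\<close>

locale section_family =
  idx: complete_measure \<Lambda> + idx: prob_space \<Lambda> + fib: prob_space P
  for \<Lambda> :: "'i measure" and P :: "'w measure" +
  fixes s :: "'i \<Rightarrow> 'w \<Rightarrow> 'z" and \<Omega> :: "'z set"
  assumes s_in: "\<And>i \<omega>. i \<in> space \<Lambda> \<Longrightarrow> \<omega> \<in> space P \<Longrightarrow> s i \<omega> \<in> \<Omega>"
begin

definition sec :: "'z set \<Rightarrow> 'i \<Rightarrow> 'w set" where
  "sec E i = {\<omega> \<in> space P. s i \<omega> \<in> E}"

text \<open>Where a section is not measurable, \<open>emeasure\<close> has the default value 0. This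
  happens on a null set, so by completeness of \<open>\<Lambda>\<close> it does not affect the
  second condition.\<close>

definition sectioned :: "'z set \<Rightarrow> bool" where
  "sectioned E \<longleftrightarrow> (AE i in \<Lambda>. sec E i \<in> sets P) \<and> (\<lambda>i. emeasure P (sec E i)) \<in> borel_measurable \<Lambda>"

text \<open>Sections commute with complements and unions, so Dynkin's argument applies; complements
  use that the fibre has total mass 1.\<close>

lemma sectioned_sigma_sets:
  assumes "Int_stable G" "G \<subseteq> Pow \<Omega>" and G: "\<And>E. E \<in> G \<Longrightarrow> sectioned E"
    and "E \<in> sigma_sets \<Omega> G"
  shows "sectioned E"
  using assms(1,2,4)
proof (induction rule: sigma_sets_induct_disjoint)
  case (basic E)
  then show ?case by (rule G)
next
  case empty
  show ?case by (simp add: sectioned_def sec_def)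
next
  case (compl E)
  have eq: "sec (\<Omega> - E) i = space P - sec E i" if "i \<in> space \<Lambda>" for i
    using that s_in by (auto simp: sec_def)
  have ae: "AE i in \<Lambda>. sec E i \<in> sets P" and meas: "(\<lambda>i. emeasure P (sec E i)) \<in> borel_measurable \<Lambda>"
    using compl by (auto simp: sectioned_def)
  have "AE i in \<Lambda>. sec (\<Omega> - E) i \<in> sets P"
    using ae AE_space
  proof eventually_elim
    case (elim i)
    then show ?case using eq[of i] by auto
  qed
  moreover have "AE i in \<Lambda>. 1 - emeasure P (sec E i) = emeasure P (sec (\<Omega> - E) i)"
    using ae AE_space
  proof eventually_elim
    case (elim i)
    then show ?case using eq[of i] emeasure_compl[of "sec E i" P] fib.emeasure_space_1 by simp
  qed
  then have "(\<lambda>i. emeasure P (sec (\<Omega> - E) i)) \<in> borel_measurable \<Lambda>"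
    by (rule idx.measurable_cong_AE[rotated]) (use meas in simp_all)
  ultimately show ?case by (simp add: sectioned_def)
next
  case (union E)
  have eq: "sec (\<Union>n. E n) i = (\<Union>n. sec (E n) i)" for i by (auto simp: sec_def)
  have disj: "disjoint_family (\<lambda>n. sec (E n) i)" for i
    using union(1) by (auto simp: disjoint_family_on_def sec_def)
  have ae: "AE i in \<Lambda>. \<forall>n. sec (E n) i \<in> sets P"
    using union(3) by (simp add: AE_all_countable sectioned_def)
  have meas: "(\<lambda>i. emeasure P (sec (E n) i)) \<in> borel_measurable \<Lambda>" for n
    using union(3) by (simp add: sectioned_def)
  have "AE i in \<Lambda>. sec (\<Union>n. E n) i \<in> sets P"
    using ae by eventually_elim (auto simp: eq)
  moreover have "AE i in \<Lambda>. (\<Sum>n. emeasure P (sec (E n) i)) = emeasure P (sec (\<Union>n. E n) i)"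
    using ae by eventually_elim (auto simp: eq intro!: suminf_emeasure disj)
  then have "(\<lambda>i. emeasure P (sec (\<Union>n. E n) i)) \<in> borel_measurable \<Lambda>"
    by (rule idx.measurable_cong_AE[rotated]) (use meas in simp_all)
  ultimately show ?case by (simp add: sectioned_def)
qed

text \<open>Integrating the measures of the sections is countably additive: a disjoint sequence has
  disjoint sections, at almost all indices all of them are measurable, and sum and integral may be
  exchanged.\<close>

lemma ex_sectioned_measure:
  assumes G: "Int_stable G" "G \<subseteq> Pow \<Omega>" "\<And>E. E \<in> G \<Longrightarrow> sectioned E"
  shows "\<exists>W. space W = \<Omega> \<and> sets W = sigma_sets \<Omega> G \<and>
    (\<forall>E\<in>sets W. sectioned E \<and> emeasure W E = (\<integral>\<^sup>+i. emeasure P (sec E i) \<partial>\<Lambda>))"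
proof -
  define \<mu> where "\<mu> E = (\<integral>\<^sup>+i. emeasure P (sec E i) \<partial>\<Lambda>)" for E
  define W where "W = measure_of \<Omega> G \<mu>"
  have space_W: "space W = \<Omega>" and sets_W: "sets W = sigma_sets \<Omega> G"
    unfolding W_def using G(2) by (rule space_measure_of, rule sets_measure_of)
  have good: "sectioned E" if "E \<in> sets W" for E
    using sectioned_sigma_sets[OF G] that sets_W by simp
  have "emeasure W E = \<mu> E" if "E \<in> sets W" for E
  proof (rule emeasure_measure_of[OF W_def G(2) _ _ that])
    show "positive (sets W) \<mu>" by (simp add: positive_def \<mu>_def sec_def)
    show "countably_additive (sets W) \<mu>"
    proof (rule countably_additiveI)
      fix E :: "nat \<Rightarrow> 'z set"
      assume E: "range E \<subseteq> sets W" "disjoint_family E"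
      have good_E: "sectioned (E n)" for n using E(1) by (intro good) auto
      have "(\<Sum>n. \<mu> (E n)) = (\<integral>\<^sup>+i. (\<Sum>n. emeasure P (sec (E n) i)) \<partial>\<Lambda>)"
        unfolding \<mu>_def using good_E by (intro nn_integral_suminf[symmetric]) (simp add: sectioned_def)
      also have "\<dots> = \<mu> (\<Union>n. E n)"
        unfolding \<mu>_def
      proof (rule nn_integral_cong_AE)
        have eq: "sec (\<Union>n. E n) i = (\<Union>n. sec (E n) i)" for i by (auto simp: sec_def)
        have disj: "disjoint_family (\<lambda>n. sec (E n) i)" for i
          using E(2) by (auto simp: disjoint_family_on_def sec_def)
        have "AE i in \<Lambda>. \<forall>n. sec (E n) i \<in> sets P"
          using good_E by (simp add: AE_all_countable sectioned_def)
        then show "AE i in \<Lambda>. (\<Sum>n. emeasure P (sec (E n) i)) = emeasure P (sec (\<Union>n. E n) i)"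
          by eventually_elim (auto simp: eq intro!: suminf_emeasure disj)
      qed
      finally show "(\<Sum>n. \<mu> (E n)) = \<mu> (\<Union>n. E n)" .
    qed
  qed
  then show ?thesis using space_W sets_W good unfolding \<mu>_def by blast
qed

context
  fixes W :: "'z measure"
  assumes space_W: "space W = \<Omega>"
    and sect: "\<And>E. E \<in> sets W \<Longrightarrow> sectioned E \<and> emeasure W E = (\<integral>\<^sup>+i. emeasure P (sec E i) \<partial>\<Lambda>)"
begin

text \<open>Tonelli's theorem by induction over nonnegative measurable functions. Most steps relate
  the section integrals only at almost all indices; completeness of \<open>\<Lambda>\<close> then
  yields their measurability.\<close>

lemma nn_integral_sections:
  fixes f :: "'z \<Rightarrow> ennreal"
  assumes "f \<in> borel_measurable W"
  shows "(AE i in \<Lambda>. (\<lambda>\<omega>. f (s i \<omega>)) \<in> borel_measurable P) \<and>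
    (\<lambda>i. \<integral>\<^sup>+\<omega>. f (s i \<omega>) \<partial>P) \<in> borel_measurable \<Lambda> \<and>
    integral\<^sup>N W f = (\<integral>\<^sup>+i. (\<integral>\<^sup>+\<omega>. f (s i \<omega>) \<partial>P) \<partial>\<Lambda>)"
  using assms
proof (induction rule: borel_measurable_induct)
  case (cong g f)
  have eq: "f (s i \<omega>) = g (s i \<omega>)" if "i \<in> space \<Lambda>" "\<omega> \<in> space P" for i \<omega>
    using cong(3) s_in that space_W by simp
  have ae: "AE i in \<Lambda>. (\<lambda>\<omega>. f (s i \<omega>)) \<in> borel_measurable P"
    and meas: "(\<lambda>i. \<integral>\<^sup>+\<omega>. f (s i \<omega>) \<partial>P) \<in> borel_measurable \<Lambda>"
    and int: "integral\<^sup>N W f = (\<integral>\<^sup>+i. (\<integral>\<^sup>+\<omega>. f (s i \<omega>) \<partial>P) \<partial>\<Lambda>)"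
    using cong by auto
  have "AE i in \<Lambda>. (\<lambda>\<omega>. g (s i \<omega>)) \<in> borel_measurable P"
    using ae AE_space
  proof eventually_elim
    case (elim i)
    then show ?case using measurable_cong[of P "\<lambda>\<omega>. f (s i \<omega>)" "\<lambda>\<omega>. g (s i \<omega>)" borel] eq by simp
  qed
  moreover have inner: "(\<integral>\<^sup>+\<omega>. f (s i \<omega>) \<partial>P) = (\<integral>\<^sup>+\<omega>. g (s i \<omega>) \<partial>P)" if "i \<in> space \<Lambda>" for i
    using eq that by (intro nn_integral_cong)
  then have "(\<lambda>i. \<integral>\<^sup>+\<omega>. g (s i \<omega>) \<partial>P) \<in> borel_measurable \<Lambda>"
    using meas measurable_cong[of \<Lambda> "\<lambda>i. \<integral>\<^sup>+\<omega>. f (s i \<omega>) \<partial>P" "\<lambda>i. \<integral>\<^sup>+\<omega>. g (s i \<omega>) \<partial>P" borel] by simp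
  moreover have "integral\<^sup>N W g = integral\<^sup>N W f"
    using cong(3) by (intro nn_integral_cong) simp
  ultimately show ?case
    using int inner nn_integral_cong[of \<Lambda> "\<lambda>i. \<integral>\<^sup>+\<omega>. f (s i \<omega>) \<partial>P" "\<lambda>i. \<integral>\<^sup>+\<omega>. g (s i \<omega>) \<partial>P"] by simp
next
  case (set E)
  have ae: "AE i in \<Lambda>. sec E i \<in> sets P"
    and meas: "(\<lambda>i. emeasure P (sec E i)) \<in> borel_measurable \<Lambda>"
    and em: "emeasure W E = (\<integral>\<^sup>+i. emeasure P (sec E i) \<partial>\<Lambda>)"
    using sect[OF set] by (auto simp: sectioned_def)
  have ind: "(indicator E (s i \<omega>) :: ennreal) = indicator (sec E i) \<omega>" if "\<omega> \<in> space P" for i \<omega>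
    using that by (auto simp: sec_def indicator_def)
  have 1: "AE i in \<Lambda>. (\<lambda>\<omega>. indicator E (s i \<omega>) :: ennreal) \<in> borel_measurable P"
    using ae
  proof eventually_elim
    case (elim i)
    then have "(indicator (sec E i) :: _ \<Rightarrow> ennreal) \<in> borel_measurable P" by simp
    then show ?case by (subst measurable_cong[OF ind])
  qed
  have 2: "AE i in \<Lambda>. emeasure P (sec E i) = (\<integral>\<^sup>+\<omega>. indicator E (s i \<omega>) \<partial>P)"
    using ae
  proof eventually_elim
    case (elim i)
    have "(\<integral>\<^sup>+\<omega>. indicator E (s i \<omega>) \<partial>P) = (\<integral>\<^sup>+\<omega>. indicator (sec E i) \<omega> \<partial>P)"
      using ind by (intro nn_integral_cong)
    then show ?case using elim by simp
  qed
  have 3: "(\<lambda>i. \<integral>\<^sup>+\<omega>. indicator E (s i \<omega>) \<partial>P) \<in> borel_measurable \<Lambda>"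
    by (rule idx.measurable_cong_AE[OF meas 2]) simp
  show ?case using 1 3 em nn_integral_cong_AE[OF 2] set by simp
next
  case (mult u c)
  have ae: "AE i in \<Lambda>. (\<lambda>\<omega>. u (s i \<omega>)) \<in> borel_measurable P"
    and meas: "(\<lambda>i. \<integral>\<^sup>+\<omega>. u (s i \<omega>) \<partial>P) \<in> borel_measurable \<Lambda>"
    and int: "integral\<^sup>N W u = (\<integral>\<^sup>+i. (\<integral>\<^sup>+\<omega>. u (s i \<omega>) \<partial>P) \<partial>\<Lambda>)"
    using mult by auto
  have 1: "AE i in \<Lambda>. (\<lambda>\<omega>. c * u (s i \<omega>)) \<in> borel_measurable P"
    using ae by eventually_elim simp
  have 2: "AE i in \<Lambda>. c * (\<integral>\<^sup>+\<omega>. u (s i \<omega>) \<partial>P) = (\<integral>\<^sup>+\<omega>. c * u (s i \<omega>) \<partial>P)"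
    using ae by eventually_elim (simp add: nn_integral_cmult)
  have 3: "(\<lambda>i. \<integral>\<^sup>+\<omega>. c * u (s i \<omega>) \<partial>P) \<in> borel_measurable \<Lambda>"
    by (rule idx.measurable_cong_AE[OF _ 2]) (use meas in simp_all)
  have "integral\<^sup>N W (\<lambda>z. c * u z) = (\<integral>\<^sup>+i. c * (\<integral>\<^sup>+\<omega>. u (s i \<omega>) \<partial>P) \<partial>\<Lambda>)"
    using mult(2) meas int by (simp add: nn_integral_cmult)
  then show ?case using 1 3 nn_integral_cong_AE[OF 2] by simp
next
  case (add u v)
  have ae: "AE i in \<Lambda>. (\<lambda>\<omega>. u (s i \<omega>)) \<in> borel_measurable P" "AE i in \<Lambda>. (\<lambda>\<omega>. v (s i \<omega>)) \<in> borel_measurable P"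
    and meas: "(\<lambda>i. \<integral>\<^sup>+\<omega>. u (s i \<omega>) \<partial>P) \<in> borel_measurable \<Lambda>" "(\<lambda>i. \<integral>\<^sup>+\<omega>. v (s i \<omega>) \<partial>P) \<in> borel_measurable \<Lambda>"
    and int: "integral\<^sup>N W u = (\<integral>\<^sup>+i. (\<integral>\<^sup>+\<omega>. u (s i \<omega>) \<partial>P) \<partial>\<Lambda>)" "integral\<^sup>N W v = (\<integral>\<^sup>+i. (\<integral>\<^sup>+\<omega>. v (s i \<omega>) \<partial>P) \<partial>\<Lambda>)"
    using add by auto
  have 1: "AE i in \<Lambda>. (\<lambda>\<omega>. v (s i \<omega>) + u (s i \<omega>)) \<in> borel_measurable P"
    using ae by eventually_elim simp
  have 2: "AE i in \<Lambda>. (\<integral>\<^sup>+\<omega>. v (s i \<omega>) \<partial>P) + (\<integral>\<^sup>+\<omega>. u (s i \<omega>) \<partial>P) = (\<integral>\<^sup>+\<omega>. v (s i \<omega>) + u (s i \<omega>) \<partial>P)"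
    using ae by eventually_elim (simp add: nn_integral_add)
  have 3: "(\<lambda>i. \<integral>\<^sup>+\<omega>. v (s i \<omega>) + u (s i \<omega>) \<partial>P) \<in> borel_measurable \<Lambda>"
    by (rule idx.measurable_cong_AE[OF _ 2]) (use meas in simp_all)
  have "integral\<^sup>N W (\<lambda>z. v z + u z) = (\<integral>\<^sup>+i. (\<integral>\<^sup>+\<omega>. v (s i \<omega>) \<partial>P) + (\<integral>\<^sup>+\<omega>. u (s i \<omega>) \<partial>P) \<partial>\<Lambda>)"
    using add.hyps meas int by (simp add: nn_integral_add)
  then show ?case using 1 3 nn_integral_cong_AE[OF 2] by simp
next
  case (seq U)
  have ae: "AE i in \<Lambda>. \<forall>n. (\<lambda>\<omega>. U n (s i \<omega>)) \<in> borel_measurable P"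
    using seq by (simp add: AE_all_countable)
  have meas: "(\<lambda>i. \<integral>\<^sup>+\<omega>. U n (s i \<omega>) \<partial>P) \<in> borel_measurable \<Lambda>"
    and int: "integral\<^sup>N W (U n) = (\<integral>\<^sup>+i. (\<integral>\<^sup>+\<omega>. U n (s i \<omega>) \<partial>P) \<partial>\<Lambda>)" for n
    using seq by auto
  have mono: "incseq (\<lambda>n \<omega>. U n (s i \<omega>))" for i
    using seq(3) by (auto simp: incseq_def le_fun_def)
  have 1: "AE i in \<Lambda>. (\<lambda>\<omega>. SUP n. U n (s i \<omega>)) \<in> borel_measurable P"
    using ae by eventually_elim (rule borel_measurable_SUP; simp)
  have 2: "AE i in \<Lambda>. (SUP n. \<integral>\<^sup>+\<omega>. U n (s i \<omega>) \<partial>P) = (\<integral>\<^sup>+\<omega>. (SUP n. U n (s i \<omega>)) \<partial>P)"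
    using ae by eventually_elim (intro nn_integral_monotone_convergence_SUP[symmetric] mono; simp)
  have 3: "(\<lambda>i. \<integral>\<^sup>+\<omega>. (SUP n. U n (s i \<omega>)) \<partial>P) \<in> borel_measurable \<Lambda>"
    by (rule idx.measurable_cong_AE[OF _ 2]) (use meas in simp_all)
  have "integral\<^sup>N W (\<lambda>z. SUP n. U n z) = (SUP n. integral\<^sup>N W (U n))"
    using seq by (intro nn_integral_monotone_convergence_SUP) auto
  also have "\<dots> = (\<integral>\<^sup>+i. (SUP n. \<integral>\<^sup>+\<omega>. U n (s i \<omega>) \<partial>P) \<partial>\<Lambda>)"
    unfolding int
    by (rule nn_integral_monotone_convergence_SUP[symmetric, OF _ meas])
       (auto simp: incseq_def le_fun_def intro!: nn_integral_mono incseqD[OF mono, THEN le_funD])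
  finally have "integral\<^sup>N W (\<lambda>z. SUP n. U n z) = (\<integral>\<^sup>+i. (\<integral>\<^sup>+\<omega>. (SUP n. U n (s i \<omega>)) \<partial>P) \<partial>\<Lambda>)"
    using nn_integral_cong_AE[OF 2] by simp
  moreover have "Sup (range U) = (\<lambda>z. SUP n. U n z)" by (auto simp: image_comp)
  ultimately show ?case using 1 3 by simp
qed

text \<open>The nonnegative case is applied to both parts of \<open>f\<close>. Each has a finite
  integral, hence finite section integrals at almost all indices, where their difference makes
  sense.\<close>

lemma integral_sections:
  fixes f :: "'z \<Rightarrow> real"
  assumes f: "integrable W f"
  shows "AE i in \<Lambda>. integrable P (\<lambda>\<omega>. f (s i \<omega>))"
    and "integrable \<Lambda> (\<lambda>i. \<integral>\<omega>. f (s i \<omega>) \<partial>P)"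
    and "(\<integral>z. f z \<partial>W) = (\<integral>i. (\<integral>\<omega>. f (s i \<omega>) \<partial>P) \<partial>\<Lambda>)"
proof -
  have f_meas [measurable]: "f \<in> borel_measurable W" using f by simp
  define p where "p i = (\<integral>\<^sup>+\<omega>. ennreal (f (s i \<omega>)) \<partial>P)" for i
  define n where "n i = (\<integral>\<^sup>+\<omega>. ennreal (- f (s i \<omega>)) \<partial>P)" for i
  have p: "AE i in \<Lambda>. (\<lambda>\<omega>. ennreal (f (s i \<omega>))) \<in> borel_measurable P" "p \<in> borel_measurable \<Lambda>"
      "(\<integral>\<^sup>+z. ennreal (f z) \<partial>W) = integral\<^sup>N \<Lambda> p"
    using nn_integral_sections[of "\<lambda>z. ennreal (f z)"] by (auto simp: p_def[abs_def])
  have n: "AE i in \<Lambda>. (\<lambda>\<omega>. ennreal (- f (s i \<omega>))) \<in> borel_measurable P" "n \<in> borel_measurable \<Lambda>"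
      "(\<integral>\<^sup>+z. ennreal (- f z) \<partial>W) = integral\<^sup>N \<Lambda> n"
    using nn_integral_sections[of "\<lambda>z. ennreal (- f z)"] by (auto simp: n_def[abs_def])
  have fin: "integral\<^sup>N \<Lambda> p < \<infinity>" "integral\<^sup>N \<Lambda> n < \<infinity>"
    using f p(3) n(3) by (auto simp: real_integrable_def top.not_eq_extremum)
  have ae_fin: "AE i in \<Lambda>. p i < \<infinity>" "AE i in \<Lambda>. n i < \<infinity>"
    using nn_integral_PInf_AE[OF p(2)] nn_integral_PInf_AE[OF n(2)] fin
    by (auto elim!: eventually_mono simp: top.not_eq_extremum)
  have ae_int: "AE i in \<Lambda>. integrable P (\<lambda>\<omega>. f (s i \<omega>)) \<and>
      enn2real (p i) - enn2real (n i) = (\<integral>\<omega>. f (s i \<omega>) \<partial>P)"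
    using p(1) n(1) ae_fin
  proof eventually_elim
    case (elim i)
    \<comment> \<open>\<open>ennreal\<close> truncates negative values to 0, so the section is the
      difference of two parts already known to be measurable.\<close>
    have "(\<lambda>\<omega>. enn2real (ennreal (f (s i \<omega>))) - enn2real (ennreal (- f (s i \<omega>)))) \<in> borel_measurable P"
      using elim(1,2) by measurable
    also have "(\<lambda>\<omega>. enn2real (ennreal (f (s i \<omega>))) - enn2real (ennreal (- f (s i \<omega>)))) = (\<lambda>\<omega>. f (s i \<omega>))"
    proof
      fix \<omega> show "enn2real (ennreal (f (s i \<omega>))) - enn2real (ennreal (- f (s i \<omega>))) = f (s i \<omega>)"
        by (cases "f (s i \<omega>) \<ge> 0") (auto simp: ennreal_neg)
    qed
    finally have "integrable P (\<lambda>\<omega>. f (s i \<omega>))"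
      using elim(3,4) by (auto simp: real_integrable_def p_def n_def)
    then show ?case by (simp add: real_lebesgue_integral_def p_def n_def)
  qed
  show "AE i in \<Lambda>. integrable P (\<lambda>\<omega>. f (s i \<omega>))" using ae_int by eventually_elim simp
  \<comment> \<open>\<open>enn2real\<close> sends the infinite value to 0, and this value is taken
    on a null set only.\<close>
  have real_p: "integrable \<Lambda> (\<lambda>i. enn2real (p i))" "(\<integral>i. enn2real (p i) \<partial>\<Lambda>) = enn2real (integral\<^sup>N \<Lambda> p)"
    if "p \<in> borel_measurable \<Lambda>" "AE i in \<Lambda>. p i < \<infinity>" "integral\<^sup>N \<Lambda> p < \<infinity>" for p :: "'i \<Rightarrow> ennreal"
  proof -
    have eq: "(\<integral>\<^sup>+i. ennreal (enn2real (p i)) \<partial>\<Lambda>) = integral\<^sup>N \<Lambda> p"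
      using that(2) by (intro nn_integral_cong_AE) (auto elim!: eventually_mono)
    then show "integrable \<Lambda> (\<lambda>i. enn2real (p i))"
      using that by (intro integrableI_nonneg) auto
    show "(\<integral>i. enn2real (p i) \<partial>\<Lambda>) = enn2real (integral\<^sup>N \<Lambda> p)"
      using that eq by (subst integral_eq_nn_integral) auto
  qed
  have int: "integrable \<Lambda> (\<lambda>i. enn2real (p i) - enn2real (n i))"
    using real_p(1)[OF p(2) ae_fin(1) fin(1)] real_p(1)[OF n(2) ae_fin(2) fin(2)] by simp
  have ae_eq: "AE i in \<Lambda>. enn2real (p i) - enn2real (n i) = (\<integral>\<omega>. f (s i \<omega>) \<partial>P)"
    using ae_int by eventually_elim simp
  have meas: "(\<lambda>i. \<integral>\<omega>. f (s i \<omega>) \<partial>P) \<in> borel_measurable \<Lambda>"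
    by (rule idx.measurable_cong_AE[OF _ ae_eq]) (use int in simp_all)
  show "integrable \<Lambda> (\<lambda>i. \<integral>\<omega>. f (s i \<omega>) \<partial>P)"
    using int meas ae_eq by (subst integrable_cong_AE[symmetric]) auto
  have "(\<integral>z. f z \<partial>W) = enn2real (integral\<^sup>N \<Lambda> p) - enn2real (integral\<^sup>N \<Lambda> n)"
    using f by (simp add: real_lebesgue_integral_def p(3) n(3))
  also have "\<dots> = (\<integral>i. enn2real (p i) - enn2real (n i) \<partial>\<Lambda>)"
    using real_p[OF p(2) ae_fin(1) fin(1)] real_p[OF n(2) ae_fin(2) fin(2)] by simp
  also have "\<dots> = (\<integral>i. (\<integral>\<omega>. f (s i \<omega>) \<partial>P) \<partial>\<Lambda>)"
    using int meas ae_eq by (intro integral_cong_AE) auto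
  finally show "(\<integral>z. f z \<partial>W) = (\<integral>i. (\<integral>\<omega>. f (s i \<omega>) \<partial>P) \<partial>\<Lambda>)" .
qed

end

end

text \<open>Serves the generators of the extension: independence makes the measure of
  \<open>X i\<close> constant at almost all indices, so integrating over \<open>A\<close> multiplies
  by this constant.\<close>

lemma (in section_family) sectioned_rectangle:
  assumes A: "A \<in> sets \<Lambda>" and X: "\<And>i. i \<in> A \<Longrightarrow> X i \<in> sets P"
    and sec: "\<And>i. i \<in> space \<Lambda> \<Longrightarrow> sec E i = (if i \<in> A then X i else {})"
    and c: "AE i in \<Lambda>. emeasure P (X i) = c"
  shows "sectioned E" and "(\<integral>\<^sup>+i. emeasure P (sec E i) \<partial>\<Lambda>) = emeasure \<Lambda> A * c"
proof -
  have ae: "AE i in \<Lambda>. c * indicator A i = emeasure P (sec E i)"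
    using c AE_space by eventually_elim (simp add: sec)
  have "(\<lambda>i. emeasure P (sec E i)) \<in> borel_measurable \<Lambda>"
    by (rule idx.measurable_cong_AE[OF _ ae]) (use A in simp_all)
  moreover have "AE i in \<Lambda>. sec E i \<in> sets P"
    using AE_space by eventually_elim (simp add: sec X)
  ultimately show "sectioned E" by (simp add: sectioned_def)
  show "(\<integral>\<^sup>+i. emeasure P (sec E i) \<partial>\<Lambda>) = emeasure \<Lambda> A * c"
    using nn_integral_cong_AE[OF ae] A by (simp add: nn_integral_cmult_indicator mult.commute)
qed

section \<open>Agreement of the two iterated integrals\<close>

text \<open>By \<open>ind1\<close> and \<open>ind2\<close>, every event on either side is
  independent of almost every section of \<open>m\<close>. Integrating in either order therefore
  gives a generator built from \<open>A\<close>, \<open>B\<close>, \<open>C\<close> the same mass, a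
  product of three measures. So the two measures defined by sections coincide, and each supplies one
  half of the Fubini property.\<close>

lemma ex_fubini_extension:
  fixes \<Lambda> :: "'i measure" and P :: "'w measure" and m :: "'i \<times> 'w \<Rightarrow> real"
  assumes \<Lambda>: "prob_space \<Lambda>" "complete_measure \<Lambda>" and P: "prob_space P" "complete_measure P"
    and U: "prob_space U" "sets U = sets borel"
    and m1: "\<And>i. i \<in> space \<Lambda> \<Longrightarrow> (\<lambda>\<omega>. m (i, \<omega>)) \<in> borel_measurable P"
    and m2: "\<And>\<omega>. \<omega> \<in> space P \<Longrightarrow> (\<lambda>i. m (i, \<omega>)) \<in> borel_measurable \<Lambda>"
    and ind1: "\<And>B. B \<in> sets P \<Longrightarrow> AE i in \<Lambda>. \<forall>C\<in>sets borel.
      emeasure P {\<omega>\<in>B. m (i, \<omega>) \<in> C} = emeasure P B * emeasure U C"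
    and ind2: "\<And>A. A \<in> sets \<Lambda> \<Longrightarrow> AE \<omega> in P. \<forall>C\<in>sets borel.
      emeasure \<Lambda> {i\<in>A. m (i, \<omega>) \<in> C} = emeasure \<Lambda> A * emeasure U C"
  shows "\<exists>W. fubini_extension \<Lambda> P W \<and> m \<in> borel_measurable W"
proof -
  interpret \<Lambda>: prob_space \<Lambda> by (rule \<Lambda>)
  interpret P: prob_space P by (rule P)
  interpret U: prob_space U by (rule U)
  define \<Omega> where "\<Omega> = space \<Lambda> \<times> space P"
  \<comment> \<open>Taking \<open>UNIV\<close> for \<open>C\<close> gives the rectangles of the
    product; taking the full spaces for \<open>A\<close> and \<open>B\<close> gives the preimages
    under \<open>m\<close>.\<close>
  define G where "G = {{z \<in> A \<times> B. m z \<in> C} |A B C. A \<in> sets \<Lambda> \<and> B \<in> sets P \<and> C \<in> sets borel}"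
  interpret L: section_family \<Lambda> P Pair \<Omega>
    using \<Lambda> P by (auto simp: section_family_def section_family_axioms_def \<Omega>_def)
  interpret R: section_family P \<Lambda> "\<lambda>\<omega> i. (i, \<omega>)" \<Omega>
    using \<Lambda> P by (auto simp: section_family_def section_family_axioms_def \<Omega>_def)
  have space_U: "space U = UNIV" using sets_eq_imp_space_eq[OF U(2)] by simp
  have U_UNIV: "emeasure U UNIV = 1" using U.emeasure_space_1 by (simp add: space_U)
  have L_rect: "L.sectioned {z \<in> A \<times> B. m z \<in> C}"
      "(\<integral>\<^sup>+i. emeasure P (L.sec {z \<in> A \<times> B. m z \<in> C} i) \<partial>\<Lambda>) = emeasure \<Lambda> A * emeasure P B * emeasure U C"
    if "A \<in> sets \<Lambda>" "B \<in> sets P" "C \<in> sets borel" for A B C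
  proof -
    have X: "{\<omega>\<in>B. m (i, \<omega>) \<in> C} \<in> sets P" if "i \<in> A" for i
    proof -
      have "i \<in> space \<Lambda>" using that \<open>A \<in> sets \<Lambda>\<close> sets.sets_into_space by blast
      then have "B \<inter> ((\<lambda>\<omega>. m (i, \<omega>)) -` C \<inter> space P) \<in> sets P"
        using measurable_sets[OF m1 \<open>C \<in> sets borel\<close>] \<open>B \<in> sets P\<close> by auto
      also have "B \<inter> ((\<lambda>\<omega>. m (i, \<omega>)) -` C \<inter> space P) = {\<omega>\<in>B. m (i, \<omega>) \<in> C}"
        using sets.sets_into_space[OF \<open>B \<in> sets P\<close>] by auto
      finally show ?thesis .
    qed
    have sec: "L.sec {z \<in> A \<times> B. m z \<in> C} i = (if i \<in> A then {\<omega>\<in>B. m (i, \<omega>) \<in> C} else {})" for i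
      using sets.sets_into_space[OF \<open>B \<in> sets P\<close>] by (auto simp: L.sec_def)
    have c: "AE i in \<Lambda>. emeasure P {\<omega>\<in>B. m (i, \<omega>) \<in> C} = emeasure P B * emeasure U C"
      using ind1[OF that(2)] by eventually_elim (use that(3) in blast)
    show "L.sectioned {z \<in> A \<times> B. m z \<in> C}"
      by (rule L.sectioned_rectangle(1)[OF that(1) X sec c])
    show "(\<integral>\<^sup>+i. emeasure P (L.sec {z \<in> A \<times> B. m z \<in> C} i) \<partial>\<Lambda>) = emeasure \<Lambda> A * emeasure P B * emeasure U C"
      by (subst L.sectioned_rectangle(2)[OF that(1) X sec c]) (simp_all add: mult.assoc)
  qed
  have R_rect: "R.sectioned {z \<in> A \<times> B. m z \<in> C}"
      "(\<integral>\<^sup>+\<omega>. emeasure \<Lambda> (R.sec {z \<in> A \<times> B. m z \<in> C} \<omega>) \<partial>P) = emeasure \<Lambda> A * emeasure P B * emeasure U C"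
    if "A \<in> sets \<Lambda>" "B \<in> sets P" "C \<in> sets borel" for A B C
  proof -
    have X: "{i\<in>A. m (i, \<omega>) \<in> C} \<in> sets \<Lambda>" if "\<omega> \<in> B" for \<omega>
    proof -
      have "\<omega> \<in> space P" using that \<open>B \<in> sets P\<close> sets.sets_into_space by blast
      then have "A \<inter> ((\<lambda>i. m (i, \<omega>)) -` C \<inter> space \<Lambda>) \<in> sets \<Lambda>"
        using measurable_sets[OF m2 \<open>C \<in> sets borel\<close>] \<open>A \<in> sets \<Lambda>\<close> by auto
      also have "A \<inter> ((\<lambda>i. m (i, \<omega>)) -` C \<inter> space \<Lambda>) = {i\<in>A. m (i, \<omega>) \<in> C}"
        using sets.sets_into_space[OF \<open>A \<in> sets \<Lambda>\<close>] by auto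
      finally show ?thesis .
    qed
    have sec: "R.sec {z \<in> A \<times> B. m z \<in> C} \<omega> = (if \<omega> \<in> B then {i\<in>A. m (i, \<omega>) \<in> C} else {})" for \<omega>
      using sets.sets_into_space[OF \<open>A \<in> sets \<Lambda>\<close>] by (auto simp: R.sec_def)
    have c: "AE \<omega> in P. emeasure \<Lambda> {i\<in>A. m (i, \<omega>) \<in> C} = emeasure \<Lambda> A * emeasure U C"
      using ind2[OF that(1)] by eventually_elim (use that(3) in blast)
    show "R.sectioned {z \<in> A \<times> B. m z \<in> C}"
      by (rule R.sectioned_rectangle(1)[OF that(2) X sec c])
    show "(\<integral>\<^sup>+\<omega>. emeasure \<Lambda> (R.sec {z \<in> A \<times> B. m z \<in> C} \<omega>) \<partial>P) = emeasure \<Lambda> A * emeasure P B * emeasure U C"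
      by (subst R.sectioned_rectangle(2)[OF that(2) X sec c]) (simp_all add: ac_simps)
  qed
  have G_Pow: "G \<subseteq> Pow \<Omega>"
    unfolding G_def \<Omega>_def by (blast dest: sets.sets_into_space)
  have G_Int: "Int_stable G"
  proof (rule Int_stableI)
    fix a b assume "a \<in> G" "b \<in> G"
    then obtain A B C A' B' C' where ab: "a = {z \<in> A \<times> B. m z \<in> C}" "b = {z \<in> A' \<times> B'. m z \<in> C'}"
      and meas: "A \<in> sets \<Lambda>" "B \<in> sets P" "C \<in> sets borel" "A' \<in> sets \<Lambda>" "B' \<in> sets P" "C' \<in> sets borel"
      unfolding G_def by blast
    have "a \<inter> b = {z \<in> (A \<inter> A') \<times> (B \<inter> B'). m z \<in> C \<inter> C'}" by (auto simp: ab)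
    then show "a \<inter> b \<in> G"
      unfolding G_def using meas by blast
  qed
  have G_rect: "{z \<in> A \<times> B. m z \<in> C} \<in> G" if "A \<in> sets \<Lambda>" "B \<in> sets P" "C \<in> sets borel" for A B C
    unfolding G_def using that by blast
  have "L.sectioned E" "R.sectioned E" if "E \<in> G" for E
    using that L_rect(1) R_rect(1) unfolding G_def by blast+
  then obtain W W' where W: "space W = \<Omega>" "sets W = sigma_sets \<Omega> G"
      "\<And>E. E \<in> sets W \<Longrightarrow> L.sectioned E \<and> emeasure W E = (\<integral>\<^sup>+i. emeasure P (L.sec E i) \<partial>\<Lambda>)"
    and W': "space W' = \<Omega>" "sets W' = sigma_sets \<Omega> G"
      "\<And>E. E \<in> sets W' \<Longrightarrow> R.sectioned E \<and> emeasure W' E = (\<integral>\<^sup>+\<omega>. emeasure \<Lambda> (R.sec E \<omega>) \<partial>P)"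
    using L.ex_sectioned_measure[OF G_Int G_Pow] R.ex_sectioned_measure[OF G_Int G_Pow] by metis
  have rect_sets: "{z \<in> A \<times> B. m z \<in> C} \<in> sets W" "{z \<in> A \<times> B. m z \<in> C} \<in> sets W'"
    if "A \<in> sets \<Lambda>" "B \<in> sets P" "C \<in> sets borel" for A B C
    using G_rect[OF that] unfolding W(2) W'(2) by (rule sigma_sets.Basic)+
  have em_W: "emeasure W {z \<in> A \<times> B. m z \<in> C} = emeasure \<Lambda> A * emeasure P B * emeasure U C"
    and em_W': "emeasure W' {z \<in> A \<times> B. m z \<in> C} = emeasure \<Lambda> A * emeasure P B * emeasure U C"
    if "A \<in> sets \<Lambda>" "B \<in> sets P" "C \<in> sets borel" for A B C
    using W(3)[OF rect_sets(1)[OF that]] W'(3)[OF rect_sets(2)[OF that]] L_rect(2)[OF that] R_rect(2)[OF that]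
    by simp_all
  have em_Times: "A \<times> B \<in> sets W" "emeasure W (A \<times> B) = emeasure \<Lambda> A * emeasure P B"
    if "A \<in> sets \<Lambda>" "B \<in> sets P" for A B
    using rect_sets(1)[OF that, of UNIV] em_W[OF that, of UNIV] U_UNIV by simp_all
  have W_1: "emeasure W \<Omega> = 1"
    using em_Times(2)[OF sets.top sets.top] by (simp add: \<Omega>_def \<Lambda>.emeasure_space_1 P.emeasure_space_1)
  \<comment> \<open>Two finite measures that agree on a generator stable under intersection; from
    here on one measure can be integrated by sections in both orders.\<close>
  have "W = W'"
  proof (rule measure_eqI_generator_eq[OF G_Int G_Pow _ W(2) W'(2), where A = "\<lambda>_. \<Omega>"])
    show "emeasure W E = emeasure W' E" if "E \<in> G" for E
      using that em_W em_W' unfolding G_def by auto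
    show "range (\<lambda>_. \<Omega>) \<subseteq> G"
      using G_rect[of "space \<Lambda>" "space P" UNIV] by (simp add: \<Omega>_def)
  qed (simp_all add: W_1)
  have prob_W: "prob_space W" using W_1 W(1) by (intro prob_spaceI) simp
  have sub: "sets (\<Lambda> \<Otimes>\<^sub>M P) \<subseteq> sets W"
  proof -
    have "{a \<times> b |a b. a \<in> sets \<Lambda> \<and> b \<in> sets P} \<subseteq> sets W" using em_Times(1) by blast
    then show ?thesis unfolding sets_pair_measure using sets.sigma_sets_subset[of _ W] W(1) by (simp add: \<Omega>_def)
  qed
  have id_meas: "(\<lambda>z. z) \<in> W \<rightarrow>\<^sub>M \<Lambda> \<Otimes>\<^sub>M P"
    using sub W(1) by (intro measurableI) (auto simp: space_pair_measure \<Omega>_def Int_absorb2 dest: sets.sets_into_space)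
  \<comment> \<open>The image of \<open>W\<close> under the identity into the smaller sigma-algebra
    is recognized as the product measure by its values on rectangles.\<close>
  have pair: "\<Lambda> \<Otimes>\<^sub>M P = distr W (\<Lambda> \<Otimes>\<^sub>M P) (\<lambda>z. z)"
  proof (rule pair_measure_eqI)
    fix A B assume AB: "A \<in> sets \<Lambda>" "B \<in> sets P"
    have "(\<lambda>z. z) -` (A \<times> B) \<inter> space W = A \<times> B"
      using sets.sets_into_space[OF em_Times(1)[OF AB]] by auto
    then show "emeasure \<Lambda> A * emeasure P B = emeasure (distr W (\<Lambda> \<Otimes>\<^sub>M P) (\<lambda>z. z)) (A \<times> B)"
      using em_Times(2)[OF AB] AB by (simp add: emeasure_distr[OF id_meas])
  qed (simp_all add: \<Lambda>.sigma_finite_measure_axioms P.sigma_finite_measure_axioms)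
  have em_pair: "emeasure W E = emeasure (\<Lambda> \<Otimes>\<^sub>M P) E" if "E \<in> sets (\<Lambda> \<Otimes>\<^sub>M P)" for E
  proof -
    have "E \<subseteq> space W" using that sub sets.sets_into_space by blast
    then show ?thesis by (subst pair) (simp add: emeasure_distr[OF id_meas that] Int_absorb2)
  qed
  have ext: "measure_extension (\<Lambda> \<Otimes>\<^sub>M P) W"
    unfolding measure_extension_def using sub em_pair W(1) by (simp add: space_pair_measure \<Omega>_def)
  have "fubini_extension \<Lambda> P W"
    unfolding fubini_extension_def
  proof (intro conjI allI impI)
    fix f :: "'i \<times> 'w \<Rightarrow> real" assume f: "integrable W f"
    note L.integral_sections[OF W(1,3) f] R.integral_sections[OF W'(1,3) f[unfolded \<open>W = W'\<close>]]
    then show "AE i in \<Lambda>. integrable P (\<lambda>\<omega>. f (i, \<omega>))" "AE \<omega> in P. integrable \<Lambda> (\<lambda>i. f (i, \<omega>))"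
      "integrable \<Lambda> (\<lambda>i. \<integral>\<omega>. f (i, \<omega>) \<partial>P)" "integrable P (\<lambda>\<omega>. \<integral>i. f (i, \<omega>) \<partial>\<Lambda>)"
      "(\<integral>z. f z \<partial>W) = (\<integral>i. (\<integral>\<omega>. f (i, \<omega>) \<partial>P) \<partial>\<Lambda>)"
      "(\<integral>z. f z \<partial>W) = (\<integral>\<omega>. (\<integral>i. f (i, \<omega>) \<partial>\<Lambda>) \<partial>P)"
      by (simp_all only: \<open>W = W'\<close>)
  qed (rule prob_W, rule ext)
  moreover have "m \<in> borel_measurable W"
  proof (rule measurableI)
    fix C :: "real set" assume "C \<in> sets borel"
    moreover have "m -` C \<inter> space W = {z \<in> space \<Lambda> \<times> space P. m z \<in> C}" by (auto simp: W(1) \<Omega>_def)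
    ultimately show "m -` C \<inter> space W \<in> sets W" using rect_sets(1) by simp
  qed simp
  ultimately show ?thesis by blast
qed

section \<open>Kernels as images of the uniform distribution\<close>

text \<open>Closed sets form a generator stable under intersection. The indicator of a closed set is
  a limit of bounded continuous functions of the distance to it, so by dominated convergence its
  mass is a limit of integrals that are weakly continuous in the measure.\<close>

lemma measurable_prob_algebra_weak_borel:
  fixes \<phi> :: "'i \<Rightarrow> 'x::polish_space measure"
  assumes \<phi>: "\<phi> \<in> \<Lambda> \<rightarrow>\<^sub>M weak_borel"
  shows "\<phi> \<in> \<Lambda> \<rightarrow>\<^sub>M prob_algebra borel"
proof (rule measurable_prob_algebra_generated)
  show "sets borel = sigma_sets UNIV (Collect closed :: 'x set set)"
    by (simp add: borel_eq_closed)
  show "Int_stable (Collect closed :: 'x set set)" by (auto simp: Int_stable_def)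
  show "(Collect closed :: 'x set set) \<subseteq> Pow UNIV" by simp
  have bpm: "\<phi> i \<in> borel_prob_measures" if "i \<in> space \<Lambda>" for i
    using measurable_space[OF \<phi> that] by (simp add: space_weak_borel)
  then show "prob_space (\<phi> i)" "sets (\<phi> i) = sets borel" if "i \<in> space \<Lambda>" for i
    using that by (auto simp: borel_prob_measures_def)
  have integral: "(\<lambda>i. \<integral>x. g x \<partial>\<phi> i) \<in> borel_measurable \<Lambda>"
    if g: "continuous_on UNIV g" "bounded (range g)" for g :: "'x \<Rightarrow> real"
  proof -
    have "(\<lambda>\<mu>. \<integral>x. g x \<partial>\<mu>) \<in> borel_measurable weak_borel"
    proof (rule borel_measurableI)
      fix U :: "real set" assume "open U"
      then have "openin weak_topology {\<mu> \<in> borel_prob_measures. (\<integral>x. g x \<partial>\<mu>) \<in> U}"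
        unfolding weak_topology_def using g by (intro topology_generated_by_Basis) blast
      moreover have "(\<lambda>\<mu>. \<integral>x. g x \<partial>\<mu>) -` U \<inter> space weak_borel = {\<mu> \<in> borel_prob_measures. (\<integral>x. g x \<partial>\<mu>) \<in> U}"
        by (auto simp: space_weak_borel)
      ultimately show "(\<lambda>\<mu>. \<integral>x. g x \<partial>\<mu>) -` U \<inter> space weak_borel \<in> sets weak_borel"
        by (auto simp: sets_weak_borel)
    qed
    then show ?thesis by (rule measurable_compose[OF \<phi>])
  qed
  fix B :: "'x set" assume "B \<in> Collect closed"
  then have B: "closed B" by simp
  show "(\<lambda>i. emeasure (\<phi> i) B) \<in> borel_measurable \<Lambda>"
  \<comment> \<open>The empty set is separated because \<open>infdist\<close> to it is 0 by
    convention, which would make every \<open>g n\<close> equal to 1.\<close>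
  proof (cases "B = {}")
    case False
    define g where "g n x = max 0 (1 - real n * infdist x B)" for n x
    have g_bound: "\<bar>g n x\<bar> \<le> 1" for n x by (simp add: g_def infdist_nonneg)
    have cont: "continuous_on UNIV (g n)" for n
      unfolding g_def by (intro continuous_intros)
    have bdd: "bounded (range (g n))" for n
      using g_bound[of n] by (auto simp: bounded_real)
    have lim: "(\<lambda>n. g n x) \<longlonglongrightarrow> indicator B x" for x
    proof (cases "x \<in> B")
      case True
      then show ?thesis by (simp add: g_def)
    next
      case out: False
      then have pos: "infdist x B > 0"
        using B \<open>B \<noteq> {}\<close> in_closed_iff_infdist_zero[of B x] infdist_nonneg[of x B] by linarith
      obtain k :: nat where k: "1 / infdist x B \<le> real k" using real_arch_simple by blast
      have "eventually (\<lambda>n. g n x = 0) sequentially"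
      proof (rule eventually_sequentiallyI)
        fix n assume "k \<le> n"
        then have "1 / infdist x B \<le> real n" using k by linarith
        then have "1 \<le> real n * infdist x B" using pos by (simp add: field_simps)
        then show "g n x = 0" by (simp add: g_def)
      qed
      then show ?thesis using out by (simp add: tendsto_eventually)
    qed
    have meas: "(\<lambda>i. measure (\<phi> i) B) \<in> borel_measurable \<Lambda>"
    proof (rule borel_measurable_LIMSEQ_real)
      show "(\<lambda>i. \<integral>x. g n x \<partial>\<phi> i) \<in> borel_measurable \<Lambda>" for n
        by (rule integral[OF cont bdd])
      fix i assume i: "i \<in> space \<Lambda>"
      interpret prob_space "\<phi> i" using bpm[OF i] by (simp add: borel_prob_measures_def)
      have s: "sets (\<phi> i) = sets borel" using bpm[OF i] by (simp add: borel_prob_measures_def)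
      have "(\<lambda>n. \<integral>x. g n x \<partial>\<phi> i) \<longlonglongrightarrow> (\<integral>x. indicator B x \<partial>\<phi> i)"
      proof (rule integral_dominated_convergence[where w = "\<lambda>_. 1"])
        show "g n \<in> borel_measurable (\<phi> i)" for n
          using borel_measurable_continuous_onI[OF cont] by (simp add: measurable_cong_sets[OF s refl])
        show "indicat_real B \<in> borel_measurable (\<phi> i)"
          using B s by (intro borel_measurable_indicator) simp
      qed (use lim g_bound in auto)
      then show "(\<lambda>n. \<integral>x. g n x \<partial>\<phi> i) \<longlonglongrightarrow> measure (\<phi> i) B"
        using B s by (simp add: borel_closed)
    qed
    have "(\<lambda>i. ennreal (measure (\<phi> i) B)) \<in> borel_measurable \<Lambda>" using meas by simp
    moreover have "ennreal (measure (\<phi> i) B) = emeasure (\<phi> i) B" if "i \<in> space \<Lambda>" for i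
      using bpm[OF that]
      by (simp add: borel_prob_measures_def finite_measure.emeasure_eq_measure prob_space.finite_measure)
    ultimately show ?thesis
      using measurable_cong[of \<Lambda> "\<lambda>i. ennreal (measure (\<phi> i) B)" "\<lambda>i. emeasure (\<phi> i) B" borel] by simp
  qed simp
qed

text \<open>Base 3 with digits 0 and 1 only: no two digit sequences name the same real number,
  and the first digit is recovered by comparing \<open>3 * y\<close> with 1.\<close>

definition ternary :: "(nat \<Rightarrow> bool) \<Rightarrow> real" where
  "ternary c = (\<Sum>k. of_bool (c k) / 3 ^ Suc k)"

definition ternary_tail :: "real \<Rightarrow> real" where
  "ternary_tail y = (if 3 * y \<ge> 1 then 3 * y - 1 else 3 * y)"

definition ternary_digit :: "real \<Rightarrow> nat \<Rightarrow> bool" where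
  "ternary_digit y k \<longleftrightarrow> 3 * (ternary_tail ^^ k) y \<ge> 1"

lemma summable_ternary: "summable (\<lambda>k. of_bool (c k) / 3 ^ Suc k :: real)"
proof (rule summable_comparison_test')
  show "summable (\<lambda>k. (1/3) ^ k :: real)" by (rule summable_geometric) simp
  show "norm (of_bool (c k) / 3 ^ Suc k :: real) \<le> (1/3) ^ k" for k
    by (simp add: power_divide field_simps)
qed

text \<open>The upper bound lies below 1, so in \<open>ternary_shift\<close> the remainder cannot be
  mistaken for a leading digit 1.\<close>

lemma ternary_bounds: "0 \<le> ternary c" "ternary c \<le> 1 / 2"
proof -
  show "0 \<le> ternary c" unfolding ternary_def using summable_ternary by (intro suminf_nonneg) auto
  have geo: "(\<lambda>k. (1/3) * (1/3) ^ k :: real) sums ((1/3) * (1 / (1 - 1/3)))"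
    by (intro sums_mult geometric_sums) simp
  have "ternary c \<le> (\<Sum>k. (1/3) * (1/3) ^ k)"
    unfolding ternary_def using summable_ternary geo
    by (intro suminf_le) (auto simp: sums_iff power_divide field_simps)
  also have "\<dots> = 1 / 2" using geo by (simp add: sums_iff)
  finally show "ternary c \<le> 1 / 2" .
qed

lemma ternary_shift: "3 * ternary c = of_bool (c 0) + ternary (\<lambda>k. c (Suc k))"
proof -
  have "ternary c = (\<Sum>k. of_bool (c (Suc k)) / 3 ^ Suc (Suc k)) + of_bool (c 0) / 3"
    using suminf_split_head[OF summable_ternary[of c]] by (simp add: ternary_def)
  also have "(\<Sum>k. of_bool (c (Suc k)) / 3 ^ Suc (Suc k)) = (\<Sum>k. of_bool (c (Suc k)) / 3 ^ Suc k / 3 :: real)"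
    by simp
  also have "\<dots> = ternary (\<lambda>k. c (Suc k)) / 3"
    unfolding ternary_def by (rule suminf_divide[OF summable_ternary])
  finally show ?thesis by simp
qed

lemma ternary_tail: "ternary_tail (ternary c) = ternary (\<lambda>k. c (Suc k))"
  using ternary_shift[of c] ternary_bounds[of "\<lambda>k. c (Suc k)"]
  by (cases "c 0") (auto simp: ternary_tail_def)

lemma ternary_digit: "ternary_digit (ternary c) k \<longleftrightarrow> c k"
proof -
  have "(ternary_tail ^^ k) (ternary c) = ternary (\<lambda>j. c (k + j))"
    by (induction k) (simp_all add: ternary_tail)
  then show ?thesis
    using ternary_shift[of "\<lambda>j. c (k + j)"] ternary_bounds[of "\<lambda>j. c (k + Suc j)"]
    by (cases "c k") (auto simp: ternary_digit_def)
qed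

lemma measurable_ternary_digit [measurable]:
  "Measurable.pred borel (\<lambda>y. ternary_digit y k)"
proof -
  have [measurable]: "ternary_tail \<in> borel_measurable borel"
    unfolding ternary_tail_def[abs_def] by measurable
  have [measurable]: "(ternary_tail ^^ k) \<in> borel_measurable borel"
    by (induction k) (simp_all add: comp_def)
  show ?thesis unfolding ternary_digit_def by measurable
qed

text \<open>A point is coded by the answers to the questions whether it lies within
  \<open>1 / real (Suc m)\<close> of the \<open>n\<close>-th point of a dense sequence. Decoding
  takes, for each \<open>m\<close>, the first dense point with a positive answer; these points
  converge to the coded one.\<close>

lemma polish_real_coding:
  obtains e :: "'x::polish_space \<Rightarrow> real" and d :: "real \<Rightarrow> 'x"
  where "e \<in> borel_measurable borel" "d \<in> borel_measurable borel" "\<And>x. d (e x) = x"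
proof -
  obtain S :: "'x set" where S: "countable S" "\<And>X. open X \<Longrightarrow> X \<noteq> {} \<Longrightarrow> \<exists>y\<in>S. y \<in> X"
    using countable_dense_setE by blast
  have "S \<noteq> {}" using S(2)[of UNIV] by auto
  define a where "a = from_nat_into S"
  have a: "\<exists>n. dist x (a n) < r" if r: "r > 0" for x r
  proof -
    obtain y where "y \<in> S" "y \<in> ball x r"
      using S(2)[of "ball x r"] r by auto
    moreover have "range a = S" unfolding a_def using \<open>S \<noteq> {}\<close> S(1) by (rule range_from_nat_into)
    ultimately show ?thesis by auto
  qed
  define c where "c x k = (case prod_decode k of (n, m) \<Rightarrow> dist x (a n) < 1 / real (Suc m))" for x k
  define e where "e x = ternary (c x)" for x
  define N where "N m y = (LEAST n. ternary_digit y (prod_encode (n, m)))" for m y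
  \<comment> \<open>A real that codes no point may produce a sequence without limit. Replacing every
    non-Cauchy sequence by a constant one makes the limit exist at all reals, by completeness, so
    that \<open>d\<close> is measurable.\<close>
  define t where "t m y = (if Cauchy (\<lambda>m. a (N m y)) then a (N m y) else a 0)" for m y
  define d where "d y = lim (\<lambda>m. t m y)" for y
  have [measurable]: "Measurable.pred borel (\<lambda>x. c x k)" for k
    unfolding c_def by (cases "prod_decode k") simp
  have "e \<in> borel_measurable borel"
    unfolding e_def[abs_def] ternary_def of_bool_def by measurable
  moreover have "d \<in> borel_measurable borel"
  proof (rule borel_measurable_LIMSEQ_metric)
    have [measurable]: "N m \<in> borel \<rightarrow>\<^sub>M count_space UNIV" for m
      unfolding N_def[abs_def] by measurable
    have [measurable]: "(\<lambda>y. a (N m y)) \<in> borel_measurable borel" for m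
      by (rule measurable_compose[of "N m" _ "count_space UNIV"]) simp_all
    show "t m \<in> borel_measurable borel" for m
      unfolding t_def[abs_def] by measurable
    fix y
    have "Cauchy (\<lambda>m. t m y)"
    proof (cases "Cauchy (\<lambda>m. a (N m y))")
      case True
      then show ?thesis by (simp add: t_def)
    next
      case False
      then show ?thesis by (simp add: t_def convergent_Cauchy convergent_const)
    qed
    then show "(\<lambda>m. t m y) \<longlonglongrightarrow> d y"
      unfolding d_def by (simp add: Cauchy_convergent convergent_LIMSEQ_iff[symmetric])
  qed
  moreover have "d (e x) = x" for x
  proof -
    have near: "dist x (a (N m (e x))) < 1 / real (Suc m)" for m
    proof -
      obtain n where "dist x (a n) < 1 / real (Suc m)" using a[of "1 / real (Suc m)"] by auto
      then have "ternary_digit (e x) (prod_encode (n, m))"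
        by (simp add: e_def ternary_digit c_def)
      then have "ternary_digit (e x) (prod_encode (N m (e x), m))"
        unfolding N_def by (rule LeastI)
      then show ?thesis by (simp add: e_def ternary_digit c_def)
    qed
    have "(\<lambda>m. dist (a (N m (e x))) x) \<longlonglongrightarrow> 0"
    proof (rule tendsto_sandwich[OF _ _ tendsto_const LIMSEQ_inverse_real_of_nat])
      show "eventually (\<lambda>m. dist (a (N m (e x))) x \<le> inverse (real (Suc m))) sequentially"
        using near by (intro always_eventually allI less_imp_le) (simp add: dist_commute inverse_eq_divide)
    qed simp
    then have lim: "(\<lambda>m. a (N m (e x))) \<longlonglongrightarrow> x" by (rule iffD2[OF tendsto_dist_iff])
    then have "Cauchy (\<lambda>m. a (N m (e x)))" by (rule LIMSEQ_imp_Cauchy)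
    then have "d (e x) = lim (\<lambda>m. a (N m (e x)))" by (simp add: d_def t_def)
    also have "\<dots> = x" using lim by (rule limI)
    finally show ?thesis .
  qed
  ultimately show ?thesis by (rule that)
qed

text \<open>The coding moves \<open>\<phi> i\<close> to the line, the quantile function of the image
  is applied to a uniform variable, and the result is decoded. Joint measurability holds because a
  quantile is at most \<open>t\<close> exactly if its level is at most the distribution function at
  \<open>t\<close>, which is measurable in \<open>i\<close>.\<close>

lemma kernel_representation:
  fixes \<phi> :: "'i \<Rightarrow> 'x::polish_space measure"
  assumes \<phi>: "\<phi> \<in> \<Lambda> \<rightarrow>\<^sub>M prob_algebra borel"
  obtains h :: "'i \<times> real \<Rightarrow> 'x" where "h \<in> borel_measurable (\<Lambda> \<Otimes>\<^sub>M borel)"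
    "\<And>i. i \<in> space \<Lambda> \<Longrightarrow> distr unif borel (\<lambda>u. h (i, u)) = \<phi> i"
proof -
  obtain e :: "'x \<Rightarrow> real" and d where e [measurable]: "e \<in> borel_measurable borel"
    and d [measurable]: "d \<in> borel_measurable borel" and de: "\<And>x. d (e x) = x"
    by (rule polish_real_coding) blast
  have \<phi>_i: "sets (\<phi> i) = sets borel" "prob_space (\<phi> i)" if "i \<in> space \<Lambda>" for i
    using measurable_space[OF \<phi> that] by (auto simp: space_prob_algebra)
  define \<psi> where "\<psi> i = distr (\<phi> i) borel e" for i
  have e_i: "e \<in> \<phi> i \<rightarrow>\<^sub>M borel" if "i \<in> space \<Lambda>" for i
    using e by (simp add: measurable_cong_sets[OF \<phi>_i(1)[OF that] refl])
  have \<psi>: "cdf_distribution (\<psi> i)" if "i \<in> space \<Lambda>" for i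
  proof -
    have "prob_space (\<psi> i)"
      unfolding \<psi>_def using \<phi>_i[OF that] e_i[OF that] by (intro prob_space.prob_space_distr)
    then show ?thesis
      by (simp add: cdf_distribution_def real_distribution_def real_distribution_axioms_def \<psi>_def)
  qed
  \<comment> \<open>Quantiles are taken on the open unit interval only; the value 0 elsewhere is
    invisible to \<open>unif\<close>.\<close>
  define q where "q = (\<lambda>(i, u). if 0 < u \<and> u < 1 then Inf {x. u \<le> cdf (\<psi> i) x} else 0)"
  have cdf [measurable]: "(\<lambda>i. cdf (\<psi> i) t) \<in> borel_measurable \<Lambda>" for t
  proof -
    have "(\<lambda>i. measure (\<phi> i) (e -` {..t})) \<in> borel_measurable \<Lambda>"
    proof -
      have "e -` {..t} \<in> sets borel" using measurable_sets[OF e, of "{..t}"] by simp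
      moreover have "\<phi> \<in> \<Lambda> \<rightarrow>\<^sub>M subprob_algebra borel" using \<phi> by (rule measurable_prob_algebraD)
      ultimately show ?thesis
        by (intro measurable_compose[OF _ measurable_measure_subprob_algebra])
    qed
    moreover have "cdf (\<psi> i) t = measure (\<phi> i) (e -` {..t})" if "i \<in> space \<Lambda>" for i
      using e_i[OF that] sets_eq_imp_space_eq[OF \<phi>_i(1)[OF that]] by (simp add: cdf_def \<psi>_def measure_distr)
    ultimately show ?thesis
      using measurable_cong[of \<Lambda> "\<lambda>i. cdf (\<psi> i) t" "\<lambda>i. measure (\<phi> i) (e -` {..t})" borel] by simp
  qed
  have q: "q \<in> borel_measurable (\<Lambda> \<Otimes>\<^sub>M borel)"
  proof (rule borel_measurableI_le)
    fix t :: real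
    have iff: "q z \<le> t \<longleftrightarrow> (if 0 < snd z \<and> snd z < 1 then snd z \<le> cdf (\<psi> (fst z)) t else 0 \<le> t)"
      if "z \<in> space (\<Lambda> \<Otimes>\<^sub>M borel)" for z
    proof -
      obtain i u where z: "z = (i, u)" by (cases z)
      then have "i \<in> space \<Lambda>" using that by (simp add: space_pair_measure)
      then interpret cdf_distribution "\<psi> i" by (rule \<psi>)
      show ?thesis using pseudoinverse[of u t] by (auto simp: z q_def)
    qed
    have "{z \<in> space (\<Lambda> \<Otimes>\<^sub>M borel). q z \<le> t} = {z \<in> space (\<Lambda> \<Otimes>\<^sub>M borel).
        if 0 < snd z \<and> snd z < 1 then snd z \<le> cdf (\<psi> (fst z)) t else 0 \<le> t}"
      using iff by blast
    also have "\<dots> \<in> sets (\<Lambda> \<Otimes>\<^sub>M borel)" by measurable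
    finally show "{z \<in> space (\<Lambda> \<Otimes>\<^sub>M borel). q z \<le> t} \<in> sets (\<Lambda> \<Otimes>\<^sub>M borel)" .
  qed
  have "distr unif borel (\<lambda>u. d (q (i, u))) = \<phi> i" if i: "i \<in> space \<Lambda>" for i
  proof -
    interpret cdf_distribution "\<psi> i" by (rule \<psi>[OF i])
    let ?R = "restrict_space lborel {0<..<1::real}"
    have q_i: "(\<lambda>u. q (i, u)) \<in> borel_measurable borel"
      using measurable_compose[OF measurable_Pair1'[OF i] q] .
    have I: "I \<in> borel_measurable ?R"
      using measurable_CI by (simp add: measurable_cong_sets[OF sets_restrict_space_cong[OF sets_lborel] refl])
    \<comment> \<open>\<open>I\<close> is the quantile function of \<open>\<psi> i\<close>. It
      agrees with \<open>q\<close> on the open unit interval, which carries all the mass of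
      \<open>unif\<close>.\<close>
    have "distr unif borel (\<lambda>u. q (i, u)) = distr ?R borel I"
    proof (rule measure_eqI)
      fix A :: "real set" assume "A \<in> sets (distr unif borel (\<lambda>u. q (i, u)))"
      then have A: "A \<in> sets borel" by simp
      have qA: "(\<lambda>u. q (i, u)) -` A \<in> sets borel" using measurable_sets[OF q_i A] by simp
      have "emeasure (distr unif borel (\<lambda>u. q (i, u))) A = emeasure lborel ({0<..<1} \<inter> (\<lambda>u. q (i, u)) -` A)"
        using A q_i qA by (simp add: emeasure_distr emeasure_unif)
      also have "{0<..<1} \<inter> (\<lambda>u. q (i, u)) -` A = I -` A \<inter> {0<..<1}"
        by (auto simp: q_def)
      also have "emeasure lborel \<dots> = emeasure (distr ?R borel I) A"
        using A I by (simp add: emeasure_distr emeasure_restrict_space space_restrict_space)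
      finally show "emeasure (distr unif borel (\<lambda>u. q (i, u))) A = emeasure (distr ?R borel I) A" .
    qed simp
    then have "distr unif borel (\<lambda>u. q (i, u)) = \<psi> i" using distr_I_eq_M by simp
    then have "distr (distr unif borel (\<lambda>u. q (i, u))) borel d = distr (distr (\<phi> i) borel e) borel d"
      by (simp add: \<psi>_def)
    moreover have "distr (distr unif borel (\<lambda>u. q (i, u))) borel d = distr unif borel (\<lambda>u. d (q (i, u)))"
      using q_i by (subst distr_distr) (auto simp: comp_def)
    moreover have "distr (distr (\<phi> i) borel e) borel d = distr (\<phi> i) borel (\<lambda>x. x)"
      using e_i[OF i] by (subst distr_distr) (auto simp: comp_def de)
    ultimately show ?thesis using distr_id2[OF \<phi>_i(1)[OF i, symmetric]] by simp
  qed
  moreover have "(\<lambda>z. d (q z)) \<in> borel_measurable (\<Lambda> \<Otimes>\<^sub>M borel)"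
    using q d by (rule measurable_compose)
  ultimately show ?thesis using that[of "\<lambda>z. d (q z)"] by simp
qed

section \<open>The Fubini extension\<close>

text \<open>The uniform distribution of the identity settles the Borel sets; completeness of
  \<open>Q\<close> adds the Lebesgue null sets.\<close>

lemma measure_extension_lebesgue:
  assumes Q: "complete_measure Q" "space Q = {0..1}"
    and id: "(\<lambda>x. x) \<in> Q \<rightarrow>\<^sub>M unif" and distr: "distr Q unif (\<lambda>x. x) = unif"
  shows "measure_extension (lebesgue_on {0..1}) Q"
proof -
  interpret Q: complete_measure Q by (rule Q)
  have em: "S \<inter> {0..1} \<in> sets Q" "emeasure Q (S \<inter> {0..1}) = emeasure unif S" if "S \<in> sets borel" for S
  proof -
    show "S \<inter> {0..1} \<in> sets Q" using measurable_sets[OF id, of S] that Q(2) by simp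
    have "emeasure (distr Q unif (\<lambda>x. x)) S = emeasure Q (S \<inter> {0..1})"
      using that Q(2) by (simp add: emeasure_distr[OF id])
    then show "emeasure Q (S \<inter> {0..1}) = emeasure unif S" by (simp add: distr)
  qed
  have "A \<in> sets Q \<and> emeasure Q A = emeasure (lebesgue_on {0..1}) A"
    if "A \<in> sets (lebesgue_on {0..1})" for A :: "real set"
  proof -
    have A: "A \<in> sets lebesgue" "A \<subseteq> {0..1}"
      using that by (auto simp: sets_restrict_space_iff)
    obtain S N N' where S: "A = S \<union> N" "N \<subseteq> N'" "N' \<in> null_sets lborel" "S \<in> sets lborel"
      using A(1) by (rule sets_completionE)
    have [measurable]: "S \<in> sets borel" "N' \<in> sets borel" using S(3,4) by auto
    have "emeasure lborel ({0<..<1} \<inter> N') \<le> emeasure lborel N'" by (rule emeasure_mono) auto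
    then have "emeasure unif N' = 0" using null_setsD1[OF S(3)] by (simp add: emeasure_unif)
    then have "N' \<inter> {0..1} \<in> null_sets Q" using em[of N'] by (intro null_setsI) auto
    then have N: "N \<in> null_sets Q"
      using S(1,2) A(2) by (intro Q.complete2[of N "N' \<inter> {0..1}"]) auto
    have S_Q: "S \<in> sets Q" "emeasure Q S = emeasure unif S"
      using em[of S] S(1) A(2) by (auto simp: Int_absorb2)
    have "emeasure Q A = emeasure Q S"
      unfolding S(1) using S_Q N by (intro emeasure_Un_null_set) auto
    also have "\<dots> = emeasure lborel ({0<..<1} \<inter> S)" by (simp add: S_Q emeasure_unif)
    \<comment> \<open>At most the two endpoints are lost, and points are null.\<close>
    also have "\<dots> = emeasure lborel S"
    proof (rule emeasure_eq_AE)
      show "AE x in lborel. x \<in> {0<..<1} \<inter> S \<longleftrightarrow> x \<in> S"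
        using AE_lborel_singleton[of 0] AE_lborel_singleton[of 1]
        by eventually_elim (use S(1) A(2) in force)
    qed auto
    also have "\<dots> = emeasure lebesgue S" by simp
    also have "\<dots> = emeasure lebesgue A"
    proof -
      have "N \<in> null_sets lebesgue"
        using S(2,3) by (simp add: null_sets_completion_iff2) blast
      then show ?thesis unfolding S(1) using S(4) by (intro emeasure_Un_null_set[symmetric]) auto
    qed
    also have "\<dots> = emeasure (lebesgue_on {0..1}) A"
      using A by (simp add: emeasure_restrict_space)
    finally show ?thesis using S_Q N S(1) by auto
  qed
  then show ?thesis by (auto simp: measure_extension_def Q(2))
qed

theorem theorem1:
  "\<exists>(\<Lambda> :: real measure) (P :: (real \<Rightarrow> real) measure) (W :: (real \<times> (real \<Rightarrow> real)) measure).
     prob_space \<Lambda> \<and> measure_extension (lebesgue_on {0..1}) \<Lambda> \<and>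
     prob_space P \<and>
     fubini_extension \<Lambda> P W \<and>
     (\<forall>\<phi> :: real \<Rightarrow> 'x::polish_space measure.
        \<phi> \<in> \<Lambda> \<rightarrow>\<^sub>M weak_borel \<longrightarrow>
        (\<exists>f :: real \<times> (real \<Rightarrow> real) \<Rightarrow> 'x.
           process \<Lambda> P f \<and>
           f \<in> borel_measurable W \<and>
           essentially_pairwise_independent \<Lambda> P f \<and>
           (AE i in \<Lambda>. distr P borel (\<lambda>\<omega>. f (i, \<omega>)) = \<phi> i)))"
proof -
  obtain M :: "real \<Rightarrow> real \<Rightarrow> real" where M0: "\<And>i. M 0 i = i"
    and rows: "\<And>D K. inj D \<Longrightarrow> compact K \<Longrightarrow> emeasure (Pi\<^sub>M (UNIV :: nat set) (\<lambda>_. unif)) K > 0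
      \<Longrightarrow> \<exists>j. (\<lambda>n. M j (D n)) \<in> K"
    and cols: "\<And>D K. inj D \<Longrightarrow> D 0 = 0 \<Longrightarrow> compact K \<Longrightarrow> emeasure (Pi\<^sub>M (UNIV :: nat set) (\<lambda>_. unif)) K > 0
      \<Longrightarrow> \<exists>i\<in>{0..1}. (\<lambda>n. M (D n) i) \<in> K"
    using generic_matrix by metis
  \<comment> \<open>Sample points have function type, but only their value at \<open>0\<close>
    counts: it names a row of \<open>M\<close>. Constant functions realize all rows.\<close>
  define m where "m = (\<lambda>(i, \<omega> :: real \<Rightarrow> real). M (\<omega> 0) i)"
  have full_cols: "\<exists>i\<in>{0..1}. (\<lambda>j. M j i) \<in> A"
    if A: "A \<in> sets (Pi\<^sub>M UNIV (\<lambda>_. unif))" "emeasure (Pi\<^sub>M UNIV (\<lambda>_. unif)) A > 0" for A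
  proof -
    obtain D K where DK: "inj D" "D 0 = 0" "compact K"
        "emeasure (Pi\<^sub>M (UNIV :: nat set) (\<lambda>_. unif)) K > 0"
      and K: "\<And>\<omega>. (\<lambda>n. \<omega> (D n)) \<in> K \<Longrightarrow> \<omega> \<in> A"
      by (rule ex_compact_cylinder[OF A]) blast
    from cols[OF DK] obtain i where i: "i \<in> {0..1}" "(\<lambda>n. M (D n) i) \<in> K" ..
    then show ?thesis using K[OF i(2)] by blast
  qed
  have full_rows: "\<exists>\<omega>\<in>UNIV. (\<lambda>i. M (\<omega> 0) i) \<in> A"
    if A: "A \<in> sets (Pi\<^sub>M UNIV (\<lambda>_. unif))" "emeasure (Pi\<^sub>M UNIV (\<lambda>_. unif)) A > 0"
    for A :: "(real \<Rightarrow> real) set"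
  proof -
    obtain D K where DK: "inj D" "D 0 = 0" "compact K"
        "emeasure (Pi\<^sub>M (UNIV :: nat set) (\<lambda>_. unif)) K > 0"
      and K: "\<And>\<omega>. (\<lambda>n. \<omega> (D n)) \<in> K \<Longrightarrow> \<omega> \<in> A"
      by (rule ex_compact_cylinder[OF A]) blast
    from rows[OF DK(1,3,4)] obtain j where "(\<lambda>n. M j (D n)) \<in> K" ..
    then have "M j \<in> A" by (rule K)
    then show ?thesis by (intro bexI[of _ "\<lambda>_. j"]) auto
  qed
  \<comment> \<open>An index is sent to its column, so the coordinate maps on the index space are
    the rows of \<open>M\<close>. On the sample space the roles are exchanged, and the coordinates
    are the variables indexed by \<open>i\<close>.\<close>
  obtain \<Lambda> where \<Lambda>: "prob_space \<Lambda>" "complete_measure \<Lambda>" "space \<Lambda> = {0..1}"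
    "\<And>j. (\<lambda>i. M j i) \<in> \<Lambda> \<rightarrow>\<^sub>M unif" "\<And>j. distr \<Lambda> unif (\<lambda>i. M j i) = unif"
    "\<And>j k. j \<noteq> k \<Longrightarrow> prob_space.indep_var \<Lambda> unif (\<lambda>i. M j i) unif (\<lambda>i. M k i)"
    "\<And>A. A \<in> sets \<Lambda> \<Longrightarrow> \<exists>D. countable D \<and> (\<forall>j. j \<notin> D \<longrightarrow> (\<forall>C\<in>sets borel.
      emeasure \<Lambda> {i\<in>A. M j i \<in> C} = emeasure \<Lambda> A * emeasure unif C))"
    by (rule ex_generic_space[of "{0..1}" "\<lambda>i j. M j i", OF full_cols], assumption, assumption, rule that)
  obtain P :: "(real \<Rightarrow> real) measure" where P: "prob_space P" "complete_measure P" "space P = UNIV"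
    "\<And>i. (\<lambda>\<omega>. M (\<omega> 0) i) \<in> P \<rightarrow>\<^sub>M unif" "\<And>i. distr P unif (\<lambda>\<omega>. M (\<omega> 0) i) = unif"
    "\<And>i k. i \<noteq> k \<Longrightarrow> prob_space.indep_var P unif (\<lambda>\<omega>. M (\<omega> 0) i) unif (\<lambda>\<omega>. M (\<omega> 0) k)"
    "\<And>A. A \<in> sets P \<Longrightarrow> \<exists>D. countable D \<and> (\<forall>i. i \<notin> D \<longrightarrow> (\<forall>C\<in>sets borel.
      emeasure P {\<omega>\<in>A. M (\<omega> 0) i \<in> C} = emeasure P A * emeasure unif C))"
    by (rule ex_generic_space[of UNIV "\<lambda>\<omega>. M (\<omega> 0)", OF full_rows], assumption, assumption, rule that)
  interpret \<Lambda>: prob_space \<Lambda> by (rule \<Lambda>)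
  interpret P: prob_space P by (rule P)
  have ae_unif: "AE u in unif. u \<noteq> c" for c
    using emeasure_unif_singleton[of c] by (intro AE_I[of _ _ "{c}"]) auto
  \<comment> \<open>Row \<open>0\<close> is the identity and uniformly distributed, so single
    indices are null.\<close>
  have ae_\<Lambda>: "AE i in \<Lambda>. i \<notin> D" if "countable D" for D
  proof -
    have "AE i in \<Lambda>. M 0 i \<noteq> c" for c
      by (rule AE_distrD[OF \<Lambda>(4)[of 0]]) (simp only: \<Lambda>(5) ae_unif)
    then have "AE i in \<Lambda>. i \<noteq> c" for c by (simp add: M0)
    then have "AE i in \<Lambda>. \<forall>c\<in>D. i \<noteq> c" using that by (intro AE_ball_countable') auto
    then show ?thesis by eventually_elim auto
  qed
  \<comment> \<open>If \<open>\<omega> 0\<close> equals \<open>c\<close>, then the uniformly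
    distributed entry in column \<open>0\<close> equals \<open>M c 0\<close>, an event of
    probability zero.\<close>
  have ae_P: "AE \<omega> in P. \<omega> 0 \<notin> D" if "countable D" for D
  proof -
    have "AE \<omega> in P. \<omega> 0 \<noteq> c" for c
    proof -
      have "AE \<omega> in P. M (\<omega> 0) 0 \<noteq> M c 0"
        by (rule AE_distrD[OF P(4)[of 0]]) (simp only: P(5) ae_unif)
      then show ?thesis by eventually_elim auto
    qed
    then have "AE \<omega> in P. \<forall>c\<in>D. \<omega> 0 \<noteq> c" using that by (intro AE_ball_countable') auto
    then show ?thesis by eventually_elim auto
  qed
  have borel_unif: "f \<in> borel_measurable N" if "f \<in> N \<rightarrow>\<^sub>M unif" for f and N :: "'b measure"
    using that by (simp add: measurable_cong_sets[OF refl sets_unif])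
  obtain W where W: "fubini_extension \<Lambda> P W" "m \<in> borel_measurable W"
  proof -
    have "\<exists>W. fubini_extension \<Lambda> P W \<and> m \<in> borel_measurable W"
    proof (rule ex_fubini_extension[OF \<Lambda>(1,2) P(1,2) unif.prob_space_axioms sets_unif])
      show "(\<lambda>\<omega>. m (i, \<omega>)) \<in> borel_measurable P" for i
        using borel_unif[OF P(4)] by (simp add: m_def)
      show "(\<lambda>i. m (i, \<omega>)) \<in> borel_measurable \<Lambda>" for \<omega>
        using borel_unif[OF \<Lambda>(4)] by (simp add: m_def)
      \<comment> \<open>All but countably many of the variables are independent of the event
        \<open>B\<close>, and countable sets of indices are null.\<close>
      show "AE i in \<Lambda>. \<forall>C\<in>sets borel. emeasure P {\<omega>\<in>B. m (i, \<omega>) \<in> C} = emeasure P B * emeasure unif C"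
        if B: "B \<in> sets P" for B
      proof -
        obtain D where D: "countable D" "\<forall>i. i \<notin> D \<longrightarrow> (\<forall>C\<in>sets borel.
            emeasure P {\<omega>\<in>B. M (\<omega> 0) i \<in> C} = emeasure P B * emeasure unif C)"
          using P(7)[OF B] by blast
        show ?thesis using ae_\<Lambda>[OF D(1)] by eventually_elim (use D(2) in \<open>simp add: m_def\<close>)
      qed
      show "AE \<omega> in P. \<forall>C\<in>sets borel. emeasure \<Lambda> {i\<in>A. m (i, \<omega>) \<in> C} = emeasure \<Lambda> A * emeasure unif C"
        if A: "A \<in> sets \<Lambda>" for A
      proof -
        obtain D where D: "countable D" "\<forall>j. j \<notin> D \<longrightarrow> (\<forall>C\<in>sets borel.
            emeasure \<Lambda> {i\<in>A. M j i \<in> C} = emeasure \<Lambda> A * emeasure unif C)"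
          using \<Lambda>(7)[OF A] by blast
        show ?thesis using ae_P[OF D(1)] by eventually_elim (use D(2) in \<open>simp add: m_def\<close>)
      qed
    qed
    then show ?thesis using that by blast
  qed
  have main: "\<exists>f :: real \<times> (real \<Rightarrow> real) \<Rightarrow> 'x. process \<Lambda> P f \<and> f \<in> borel_measurable W \<and>
      essentially_pairwise_independent \<Lambda> P f \<and> (AE i in \<Lambda>. distr P borel (\<lambda>\<omega>. f (i, \<omega>)) = \<phi> i)"
    if "\<phi> \<in> \<Lambda> \<rightarrow>\<^sub>M weak_borel" for \<phi> :: "real \<Rightarrow> 'x measure"
  proof -
    have \<phi>: "\<phi> \<in> \<Lambda> \<rightarrow>\<^sub>M prob_algebra borel"
      using that by (rule measurable_prob_algebra_weak_borel)
    obtain h :: "real \<times> real \<Rightarrow> 'x" where h: "h \<in> borel_measurable (\<Lambda> \<Otimes>\<^sub>M borel)"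
      "\<And>i. i \<in> space \<Lambda> \<Longrightarrow> distr unif borel (\<lambda>u. h (i, u)) = \<phi> i"
      by (rule kernel_representation[OF \<phi>]) blast
    \<comment> \<open>At index \<open>i\<close> the uniform variable \<open>m (i, \<omega>)\<close>
      passes through the map \<open>h (i, _)\<close>, which gives it the distribution
      \<open>\<phi> i\<close>.\<close>
    define f where "f = (\<lambda>(i, \<omega>). h (i, m (i, \<omega>)))"
    have h_i: "(\<lambda>u. h (i, u)) \<in> unif \<rightarrow>\<^sub>M borel" if "i \<in> space \<Lambda>" for i
      using measurable_compose[OF measurable_Pair1'[OF that] h(1)]
      by (simp add: measurable_cong_sets[OF sets_unif refl])
    have f_i: "(\<lambda>\<omega>. f (i, \<omega>)) = (\<lambda>u. h (i, u)) \<circ> (\<lambda>\<omega>. M (\<omega> 0) i)" for i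
      by (simp add: f_def m_def comp_def)
    have distr_f: "distr P borel (\<lambda>\<omega>. f (i, \<omega>)) = \<phi> i" if "i \<in> space \<Lambda>" for i
      unfolding f_i using h(2)[OF that] distr_distr[OF h_i[OF that] P(4)[of i]] by (simp add: P(5))
    have "process \<Lambda> P f"
      unfolding process_def
    proof (intro conjI ballI)
      show "AE i in \<Lambda>. (\<lambda>\<omega>. f (i, \<omega>)) \<in> borel_measurable P"
        unfolding f_i by (intro AE_I2 measurable_comp[OF P(4) h_i])
      fix B :: "'x set" assume "B \<in> sets borel"
      then have "(\<lambda>i. measure (\<phi> i) B) \<in> borel_measurable \<Lambda>"
        by (intro measurable_compose[OF measurable_prob_algebraD[OF \<phi>] measurable_measure_subprob_algebra])
      then show "(\<lambda>i. measure (distr P borel (\<lambda>\<omega>. f (i, \<omega>))) B) \<in> borel_measurable \<Lambda>"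
        using measurable_cong[of \<Lambda> "\<lambda>i. measure (distr P borel (\<lambda>\<omega>. f (i, \<omega>))) B" "\<lambda>i. measure (\<phi> i) B" borel]
        by (simp add: distr_f)
    qed
    moreover have "f \<in> borel_measurable W"
    proof -
      have ext: "measure_extension (\<Lambda> \<Otimes>\<^sub>M P) W" using W(1) by (simp add: fubini_extension_def)
      have "(\<lambda>z. z) \<in> W \<rightarrow>\<^sub>M \<Lambda> \<Otimes>\<^sub>M P"
      proof (rule measurableI)
        fix A assume A: "A \<in> sets (\<Lambda> \<Otimes>\<^sub>M P)"
        then have "A \<in> sets W" using ext by (auto simp: measure_extension_def)
        then show "(\<lambda>z. z) -` A \<inter> space W \<in> sets W" by simp
      qed (use ext in \<open>simp add: measure_extension_def\<close>)
      then have "fst \<in> W \<rightarrow>\<^sub>M \<Lambda>" by (rule measurable_compose[OF _ measurable_fst])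
      then have "(\<lambda>z. (fst z, m z)) \<in> W \<rightarrow>\<^sub>M \<Lambda> \<Otimes>\<^sub>M borel" using W(2) by (rule measurable_Pair)
      then have "(\<lambda>z. h (fst z, m z)) \<in> borel_measurable W" using h(1) by (rule measurable_compose)
      then show ?thesis by (simp add: f_def case_prod_beta')
    qed
    moreover have "essentially_pairwise_independent \<Lambda> P f"
      unfolding essentially_pairwise_independent_def
    proof (rule AE_I2)
      fix k assume k: "k \<in> space \<Lambda>"
      \<comment> \<open>Distinct indices give independent variables, and the single index
        \<open>k\<close> is null.\<close>
      show "AE i in \<Lambda>. P.indep_var borel (\<lambda>\<omega>. f (k, \<omega>)) borel (\<lambda>\<omega>. f (i, \<omega>))"
        using ae_\<Lambda>[of "{k}", simplified] AE_space
      proof eventually_elim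
        case (elim i)
        then show ?case
          unfolding f_i using P(6)[of k i] h_i[OF k] h_i[of i] by (intro P.indep_var_compose) auto
      qed
    qed
    moreover have "AE i in \<Lambda>. distr P borel (\<lambda>\<omega>. f (i, \<omega>)) = \<phi> i"
      by (rule AE_I2) (rule distr_f)
    ultimately show ?thesis by blast
  qed
  have "measure_extension (lebesgue_on {0..1}) \<Lambda>"
    using measure_extension_lebesgue[OF \<Lambda>(2,3)] \<Lambda>(4)[of 0] \<Lambda>(5)[of 0] by (simp add: M0)
  then show ?thesis using \<Lambda>(1) P(1) W(1) main by blast
qed

end
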